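(* For every $n\ge 4$, the set $\mathcal{L}_{n,n-2}$ is not convex. Consequently, the set $\lambda(\mathcal{S}^{n,n-2})$ is not convex for every $n\ge 4$.
   Context: $\mathcal{S}^{n,d}$ is the set of real symmetric $n\times n$ matrices all of whose $d\times d$ principal submatrices are positive semidefinite. $\lambda(\mathcal{S}^{n,d})$ is the set of all $(\lambda_1,\dots,\lambda_n)\in\mathbb{R}^n$ such that some $X\in\mathcal{S}^{n,d}$ is similar to $\operatorname{diag}(\lambda_1,\dots,\lambda_n)$. $\mathcal{L}_{n,d}:=\{(s,t)\in\mathbb{R}^2 : (1,\dots,1,s,t)\in\lambda(\mathcal{S}^{n,d})\}$ (with $n-2$ ones). *)

theory Defs
  imports
    "HOL-Analysis.Convex"
    "Jordan_Normal_Form.Matrix"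
    "Jordan_Normal_Form.DL_Submatrix"
begin

definition symmetric_mat :: "real mat \<Rightarrow> bool" where
  "symmetric_mat A \<longleftrightarrow> transpose_mat A = A"

definition psd_mat :: "real mat \<Rightarrow> bool" where
  "psd_mat A \<longleftrightarrow> symmetric_mat A \<and>
    (\<forall>x \<in> carrier_vec (dim_row A). 0 \<le> x \<bullet> (A *\<^sub>v x))"

definition locally_psd :: "nat \<Rightarrow> nat \<Rightarrow> real mat set" where
  "locally_psd n d = {X \<in> carrier_mat n n. symmetric_mat X \<and>
    (\<forall>I. I \<subseteq> {0..<n} \<and> card I = d \<longrightarrow> psd_mat (submatrix X I I))}"

(* The tuples are not sorted: every ordering of the eigenvalues of X occurs. *)
definition eigenvalue_vectors :: "nat \<Rightarrow> real mat set \<Rightarrow> real vec set" where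
  "eigenvalue_vectors n M =
    {v \<in> carrier_vec n. \<exists>X \<in> M. similar_mat X (mat_diag n (\<lambda>i. v $ i))}"

definition two_eigenvalue_slice :: "nat \<Rightarrow> nat \<Rightarrow> (real \<times> real) set" where
  "two_eigenvalue_slice n d =
    {(s, t). vec_of_list (replicate (n - 2) 1 @ [s, t]) \<in> eigenvalue_vectors n (locally_psd n d)}"

(* The type of vectors of arbitrary dimension is not a real vector space, so the
   constant convex does not apply to it; this is the same definition with the
   operations on vectors. *)
definition convex_vecs :: "real vec set \<Rightarrow> bool" where
  "convex_vecs S \<longleftrightarrow> (\<forall>x\<in>S. \<forall>y\<in>S. \<forall>u\<ge>0. \<forall>v\<ge>0. u + v = 1 \<longrightarrow> u \<cdot>\<^sub>v x + v \<cdot>\<^sub>v y \<in> S)"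

end

theory Submission
  imports Defs "Jordan_Normal_Form.Determinant"
begin

text \<open>
  A symmetric matrix with eigenvalues \<open>1, \<dots>, 1, s, t\<close> (with \<open>s\<close>, \<open>t\<close>, \<open>1\<close> distinct) is
  \<open>1 - (1 - s) a a\<^sup>T - (1 - t) b b\<^sup>T\<close> for orthonormal vectors \<open>a\<close>, \<open>b\<close>. When \<open>s, t < 1\<close>, its
  principal submatrix of size \<open>n - 2\<close> obtained by deleting \<open>i\<close> and \<open>j\<close> is positive semidefinite iff
  the Gram form \<open>(c a\<^sub>i + d b\<^sub>i)\<^sup>2 + (c a\<^sub>j + d b\<^sub>j)\<^sup>2\<close> of the two plane vectors \<open>(a\<^sub>i, b\<^sub>i)\<close> and
  \<open>(a\<^sub>j, b\<^sub>j)\<close> dominates \<open>x c\<^sup>2 + y d\<^sup>2\<close>, where \<open>x = - s / (1 - s)\<close> and \<open>y = - t / (1 - t)\<close>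
  (\<open>rank_two_update_locally_psd_iff\<close>). Membership in the slice thus becomes a question about \<open>n\<close>
  vectors in the plane.

  The slice contains the point \<open>(- 1 / (n - 2), 0)\<close>, where \<open>(x, y) = (1 / (n - 1), 0)\<close>, and a point
  \<open>(- \<epsilon>, - \<epsilon>)\<close> with \<open>\<epsilon> > 0\<close> (\<open>extreme_point_mem\<close>, \<open>diagonal_point_mem\<close>). It does not contain the
  segment between them: going from the first point to negative \<open>t\<close>, the boundary of the slice leaves
  faster than every line. More precisely, for every \<open>K\<close> there is no admissible system of plane vectors
  with \<open>y\<close> positive and small and \<open>1 / (n - 1) - K y \<le> x \<le> 1 / (n - 1)\<close>
  (\<open>no_frame_near_extreme_point\<close>).

  For this, write \<open>D\<^sub>i\<^sub>j = a\<^sub>i b\<^sub>j - a\<^sub>j b\<^sub>i\<close>. The condition on a pair implies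
  \<open>D\<^sub>i\<^sub>j\<^sup>2 \<ge> x (b\<^sub>i\<^sup>2 + b\<^sub>j\<^sup>2) + y (a\<^sub>i\<^sup>2 + a\<^sub>j\<^sup>2 - x)\<close>. The left sides sum to \<open>1\<close>, and comparison with the
  sum of the right sides shows that all these inequalities are equalities up to \<open>O(y)\<close>
  (\<open>wedge_upper\<close>). Let \<open>\<bar>b\<^sub>k\<bar>\<close> be the largest entry. The relation
  \<open>b\<^sub>k D\<^sub>i\<^sub>j + b\<^sub>i D\<^sub>j\<^sub>k + b\<^sub>j D\<^sub>k\<^sub>i = 0\<close> is compatible with \<open>D\<^sub>i\<^sub>j\<^sup>2 = x (b\<^sub>i\<^sup>2 + b\<^sub>j\<^sup>2) + O(y)\<close> only if
  \<open>b\<^sub>i b\<^sub>j = O(y)\<close> for \<open>i, j \<noteq> k\<close> (\<open>three_term_bound\<close>). Since every pair also satisfies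
  \<open>b\<^sub>i\<^sup>2 + b\<^sub>j\<^sup>2 \<ge> y\<close>, all entries \<open>b\<^sub>i\<close> with \<open>i \<noteq> k\<close> are \<open>O(sqrt y)\<close> (\<open>dominant_coordinate\<close>).
  This forces \<open>a\<^sub>i\<^sup>2 = 1 / (n - 1) + O(y)\<close> for
  \<open>i \<noteq> k\<close>. As \<open>n \<ge> 4\<close>, there are three such indices, and two of them have \<open>a\<^sub>i b\<^sub>i a\<^sub>j b\<^sub>j \<ge> 0\<close>. For
  this pair \<open>D\<^sub>i\<^sub>j\<^sup>2 \<le> a\<^sub>i\<^sup>2 b\<^sub>j\<^sup>2 + a\<^sub>j\<^sup>2 b\<^sub>i\<^sup>2 = x (b\<^sub>i\<^sup>2 + b\<^sub>j\<^sup>2) + O(y\<^sup>2)\<close>, which contradicts the lower bound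
  since \<open>a\<^sub>i\<^sup>2 + a\<^sub>j\<^sup>2 - x\<close> is close to \<open>1 / (n - 1)\<close> (\<open>y_bounded_below\<close>).

  The set of all eigenvalue vectors is not convex because the slice is its preimage under an affine
  map.
\<close>

section \<open>Determinants of vectors in the plane\<close>

text \<open>
  A pair of vectors \<open>a\<close>, \<open>b\<close> is regarded as the family of plane vectors \<open>(a i, b i)\<close>.
\<close>

definition wedge :: "(nat \<Rightarrow> real) \<Rightarrow> (nat \<Rightarrow> real) \<Rightarrow> nat \<Rightarrow> nat \<Rightarrow> real" where
  "wedge a b i j = a i * b j - a j * b i"

text \<open>
  Lagrange's identity.
\<close>

lemma sum_wedge_squares:
  assumes "finite I"
  shows "(\<Sum>i\<in>I. \<Sum>j\<in>I. (wedge a b i j)\<^sup>2)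
    = 2 * ((\<Sum>i\<in>I. (a i)\<^sup>2) * (\<Sum>i\<in>I. (b i)\<^sup>2) - (\<Sum>i\<in>I. a i * b i)\<^sup>2)"
proof -
  have "(wedge a b i j)\<^sup>2
      = (a i)\<^sup>2 * (b j)\<^sup>2 + (b i)\<^sup>2 * (a j)\<^sup>2 - 2 * ((a i * b i) * (a j * b j))" for i j
    by (simp add: wedge_def power2_eq_square algebra_simps)
  then show ?thesis
    by (simp add: sum.distrib sum_subtractf power2_eq_square[of "sum _ _"]
        flip: sum_distrib_left sum_distrib_right)
qed

text \<open>
  If \<open>w d\<close> is minus the sum of two terms of equal sign, then
  \<open>w\<^sup>2 d\<^sup>2 = (u e)\<^sup>2 + (v f)\<^sup>2 + 2 (u e) (v f)\<close>. The bounds on \<open>d\<close>, \<open>e\<close>, \<open>f\<close> turn this into a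
  comparison in which \<open>x w\<^sup>2 (u\<^sup>2 + v\<^sup>2)\<close> cancels; the cross term, at least \<open>2 x w\<^sup>2 \<bar>u v\<bar>\<close>, has
  to fit below \<open>w\<^sup>2 E\<close>.
\<close>

lemma product_le_by_dominant_term:
  fixes u v w d e f x E :: real
  assumes rel: "w * d + u * e + v * f = 0"
    and same_sign: "0 \<le> (u * e) * (v * f)"
    and upper: "d\<^sup>2 \<le> x * (u\<^sup>2 + v\<^sup>2) + E"
    and lower: "x * (v\<^sup>2 + w\<^sup>2) \<le> e\<^sup>2" "x * (u\<^sup>2 + w\<^sup>2) \<le> f\<^sup>2"
    and "0 \<le> x" "w \<noteq> 0"
  shows "2 * x * \<bar>u * v\<bar> \<le> E"
proof -
  have "x * w\<^sup>2 \<le> e\<^sup>2" "x * w\<^sup>2 \<le> f\<^sup>2"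
    using lower \<open>0 \<le> x\<close> by (smt (verit) mult_nonneg_nonneg zero_le_power2 distrib_left)+
  then have "(x * w\<^sup>2)\<^sup>2 \<le> e\<^sup>2 * f\<^sup>2"
    using \<open>0 \<le> x\<close> by (metis mult_mono power2_eq_square mult_nonneg_nonneg zero_le_power2)
  then have ef: "x * w\<^sup>2 \<le> \<bar>e * f\<bar>"
    using \<open>0 \<le> x\<close> by (metis abs_le_square_iff abs_of_nonneg mult_nonneg_nonneg power_mult_distrib zero_le_power2)
  have "(u * e) * (v * f) = \<bar>u * v\<bar> * \<bar>e * f\<bar>"
    using same_sign by (simp add: abs_mult[symmetric] mult_ac)
  then have cross: "\<bar>u * v\<bar> * (x * w\<^sup>2) \<le> (u * e) * (v * f)"
    using ef by (simp add: mult_left_mono)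
  have "w * d = - (u * e + v * f)" using rel by simp
  then have "w\<^sup>2 * d\<^sup>2 = (u * e + v * f)\<^sup>2"
    by (metis power2_minus power_mult_distrib)
  also have "\<dots> = u\<^sup>2 * e\<^sup>2 + v\<^sup>2 * f\<^sup>2 + 2 * ((u * e) * (v * f))"
    by (simp add: power2_eq_square algebra_simps)
  finally have "u\<^sup>2 * e\<^sup>2 + v\<^sup>2 * f\<^sup>2 + 2 * (\<bar>u * v\<bar> * (x * w\<^sup>2)) \<le> w\<^sup>2 * d\<^sup>2"
    using cross by simp
  moreover have "w\<^sup>2 * d\<^sup>2 \<le> w\<^sup>2 * (x * (u\<^sup>2 + v\<^sup>2) + E)"
    using upper by (intro mult_left_mono) auto
  moreover have "u\<^sup>2 * (x * (v\<^sup>2 + w\<^sup>2)) \<le> u\<^sup>2 * e\<^sup>2" "v\<^sup>2 * (x * (u\<^sup>2 + w\<^sup>2)) \<le> v\<^sup>2 * f\<^sup>2"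
    using lower by (auto intro: mult_left_mono)
  moreover have "0 \<le> x * (u\<^sup>2 * v\<^sup>2)" using \<open>0 \<le> x\<close> by simp
  ultimately have "w\<^sup>2 * (2 * x * \<bar>u * v\<bar>) \<le> w\<^sup>2 * E"
    by (simp add: algebra_simps)
  then show ?thesis using \<open>w \<noteq> 0\<close> by simp
qed

text \<open>
  Three vectors in the plane are linearly dependent, with the pairwise determinants as
  coefficients. Among the three terms of this relation in the second coordinates, two have the same
  sign, and whichever pair that is, the previous bound applies to it. Since \<open>\<bar>b k\<bar>\<close> is the largest
  of the three, the bound for \<open>b i * b j\<close> follows in each case.
\<close>

lemma three_term_bound:
  fixes a b :: "nat \<Rightarrow> real"
  assumes bounds: "\<And>r s. r \<in> {i, j, k} \<Longrightarrow> s \<in> {i, j, k} \<Longrightarrow> r \<noteq> s \<Longrightarrow>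
      x * ((b r)\<^sup>2 + (b s)\<^sup>2) \<le> (wedge a b r s)\<^sup>2 \<and>
      (wedge a b r s)\<^sup>2 \<le> x * ((b r)\<^sup>2 + (b s)\<^sup>2) + E"
    and distinct: "i \<noteq> j" "j \<noteq> k" "k \<noteq> i"
    and "0 \<le> x" "0 \<le> E" and max: "\<bar>b i\<bar> \<le> \<bar>b k\<bar>" "\<bar>b j\<bar> \<le> \<bar>b k\<bar>"
  shows "2 * x * \<bar>b i * b j\<bar> \<le> E"
proof (cases "b i = 0 \<or> b j = 0")
  case True
  then show ?thesis using \<open>0 \<le> E\<close> by auto
next
  case False
  then have nz: "b i \<noteq> 0" "b j \<noteq> 0" "b k \<noteq> 0" using max by auto
  let ?D = "wedge a b"
  have rel: "b k * ?D i j + b i * ?D j k + b j * ?D k i = 0"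
    by (simp add: wedge_def algebra_simps)
  note dist = distinct distinct[symmetric]
  have mono: "\<bar>b i * b j\<bar> \<le> \<bar>b j * b k\<bar>" "\<bar>b i * b j\<bar> \<le> \<bar>b k * b i\<bar>"
    using mult_left_mono[OF max(1), of "\<bar>b j\<bar>"] mult_left_mono[OF max(2), of "\<bar>b i\<bar>"]
    by (simp_all add: abs_mult mult.commute)
  define P where "P = b k * ?D i j"
  define Q where "Q = b i * ?D j k"
  define R where "R = b j * ?D k i"
  have "0 \<le> P * Q \<or> 0 \<le> Q * R \<or> 0 \<le> R * P"
    by (smt (verit) mult_nonneg_nonneg mult_nonpos_nonpos)
  then consider "0 \<le> Q * R" | "0 \<le> R * P" | "0 \<le> P * Q" by blast
  then show ?thesis
  proof cases
    case 1
    show ?thesis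
      by (rule product_le_by_dominant_term[of "b k" "?D i j" "b i" "?D j k" "b j" "?D k i"])
        (use rel 1 bounds[of i j] bounds[of j k] bounds[of k i] dist nz \<open>0 \<le> x\<close>
          in \<open>auto simp: Q_def R_def algebra_simps\<close>)
  next
    case 2
    have "2 * x * \<bar>b j * b k\<bar> \<le> E"
      by (rule product_le_by_dominant_term[of "b i" "?D j k" "b j" "?D k i" "b k" "?D i j"])
        (use rel 2 bounds[of i j] bounds[of j k] bounds[of k i] dist nz \<open>0 \<le> x\<close>
          in \<open>auto simp: P_def R_def algebra_simps\<close>)
    then show ?thesis using mono(1) \<open>0 \<le> x\<close>
      by (smt (verit) mult_left_mono)
  next
    case 3
    have "2 * x * \<bar>b k * b i\<bar> \<le> E"
      by (rule product_le_by_dominant_term[of "b j" "?D k i" "b k" "?D i j" "b i" "?D j k"])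
        (use rel 3 bounds[of i j] bounds[of j k] bounds[of k i] dist nz \<open>0 \<le> x\<close>
          in \<open>auto simp: P_def Q_def algebra_simps\<close>)
    then show ?thesis using mono(2) \<open>0 \<le> x\<close>
      by (smt (verit) mult_left_mono)
  qed
qed

lemma nonneg_binary_form_discriminant:
  fixes \<alpha> \<beta> \<gamma> :: real
  assumes form: "\<And>c d. 0 \<le> \<alpha> * c\<^sup>2 + 2 * \<gamma> * (c * d) + \<beta> * d\<^sup>2"
  shows "\<gamma>\<^sup>2 \<le> \<alpha> * \<beta>"
proof (cases "\<beta> = 0")
  case True
  \<comment> \<open>Otherwise the form is linear and nonconstant in \<open>d\<close>; the witness makes it \<open>-1\<close>.\<close>
  have "\<gamma> = 0"
  proof (rule ccontr)
    assume "\<gamma> \<noteq> 0"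
    then show False using form[of 1 "- (\<alpha> + 1) / (2 * \<gamma>)"] True by (simp add: field_simps)
  qed
  then show ?thesis using True by simp
next
  case False
  then have "0 < \<beta>" using form[of 0 1] by simp
  have "0 \<le> \<beta> * (\<alpha> * \<beta> - \<gamma>\<^sup>2)"
    using form[of \<beta> "- \<gamma>"] by (simp add: power2_eq_square algebra_simps)
  then show ?thesis using \<open>0 < \<beta>\<close> by (simp add: zero_le_mult_iff)
qed

text \<open>
  The hypothesis says that the Gram form of the two plane vectors dominates \<open>diag(x, y)\<close>; the
  conclusion is that the determinant of the difference is nonnegative, written with Lagrange's
  identity for two indices.
\<close>

lemma pair_form_imp_wedge_bound:
  assumes "\<And>c d. x * c\<^sup>2 + y * d\<^sup>2 \<le> (c * a i + d * b i)\<^sup>2 + (c * a j + d * b j)\<^sup>2"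
  shows "x * ((b i)\<^sup>2 + (b j)\<^sup>2) + y * ((a i)\<^sup>2 + (a j)\<^sup>2) - x * y \<le> (wedge a b i j)\<^sup>2"
proof -
  have "(a i * b i + a j * b j)\<^sup>2 \<le> ((a i)\<^sup>2 + (a j)\<^sup>2 - x) * ((b i)\<^sup>2 + (b j)\<^sup>2 - y)"
  proof (rule nonneg_binary_form_discriminant)
    show "0 \<le> ((a i)\<^sup>2 + (a j)\<^sup>2 - x) * c\<^sup>2 + 2 * (a i * b i + a j * b j) * (c * d)
        + ((b i)\<^sup>2 + (b j)\<^sup>2 - y) * d\<^sup>2" for c d
      using assms[of c d] by (simp add: power2_eq_square algebra_simps)
  qed
  then show ?thesis by (simp add: wedge_def power2_eq_square algebra_simps)
qed

definition orthonormal_pair :: "nat \<Rightarrow> (nat \<Rightarrow> real) \<Rightarrow> (nat \<Rightarrow> real) \<Rightarrow> bool" where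
  "orthonormal_pair n a b \<longleftrightarrow>
     (\<Sum>i<n. (a i)\<^sup>2) = 1 \<and> (\<Sum>i<n. (b i)\<^sup>2) = 1 \<and> (\<Sum>i<n. a i * b i) = 0"

lemma orthonormal_pair_coordinate:
  fixes a b :: "nat \<Rightarrow> real"
  assumes "orthonormal_pair n a b" "k < n"
  shows "(a k)\<^sup>2 + (b k)\<^sup>2 \<le> 1"
proof -
  \<comment> \<open>The sum of squares below is the squared distance of the unit vector \<open>e k\<close> to
    the span of \<open>a\<close> and \<open>b\<close>.\<close>
  have "((if i = k then 1 else 0) - a k * a i - b k * b i)\<^sup>2
      = (if i = k then 1 - 2 * (a k)\<^sup>2 - 2 * (b k)\<^sup>2 else 0)
        + (a k)\<^sup>2 * (a i)\<^sup>2 + (b k)\<^sup>2 * (b i)\<^sup>2 + 2 * a k * b k * (a i * b i)" for i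
    by (simp add: power2_eq_square algebra_simps)
  then have "(\<Sum>i<n. ((if i = k then 1 else 0) - a k * a i - b k * b i)\<^sup>2)
      = 1 - (a k)\<^sup>2 - (b k)\<^sup>2"
    using assms by (simp add: orthonormal_pair_def sum.distrib flip: sum_distrib_left)
  moreover have "0 \<le> (\<Sum>i<n. ((if i = k then 1 else 0) - a k * a i - b k * b i)\<^sup>2)"
    by (rule sum_nonneg) simp
  ultimately show ?thesis by simp
qed

section \<open>Frames near the extreme point\<close>

text \<open>
  Constants of the estimates below. In a frame satisfying the hypotheses that follow, the squared
  determinants exceed their lower bounds by at most \<open>slack_const n K * y\<close>, all squares \<open>(b i)\<^sup>2\<close> but
  one are at most \<open>small_const n K * y\<close>, and for the same indices \<open>(a i)\<^sup>2\<close> exceeds \<open>x\<close> by at most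
  \<open>row_const n K * y\<close>. What matters is that they depend on \<open>n\<close> and \<open>K\<close> only.
\<close>

definition slack_const :: "nat \<Rightarrow> real \<Rightarrow> real" where
  "slack_const n K = (real n - 1) * K + 1"

definition small_const :: "nat \<Rightarrow> real \<Rightarrow> real" where
  "small_const n K = 2 * (slack_const n K)\<^sup>2 * (real n - 1)\<^sup>2"

definition row_const :: "nat \<Rightarrow> real \<Rightarrow> real" where
  "row_const n K = slack_const n K + (2 * (real n - 1) + 1) * small_const n K"

lemma frame_consts_pos:
  assumes "4 \<le> n" "0 \<le> K"
  shows "0 < slack_const n K" "0 < small_const n K" "0 < row_const n K"
proof -
  show E: "0 < slack_const n K" using assms by (simp add: slack_const_def add_nonneg_pos)
  then show M: "0 < small_const n K" using assms by (simp add: small_const_def)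
  show "0 < row_const n K" using E M assms by (simp add: row_const_def add_pos_pos)
qed

text \<open>
  Orthonormal \<open>a\<close>, \<open>b\<close> in which the Gram form of every pair of plane vectors \<open>(a i, b i)\<close>
  dominates \<open>diag(x, y)\<close>. Summing the determinant conditions over all pairs shows that \<open>x\<close> cannot
  exceed \<open>1 / (n - 1)\<close> when \<open>y = 0\<close>; here \<open>y\<close> is positive and \<open>x\<close> falls short of that extreme value
  by at most \<open>K * y\<close>. The results up to \<open>y_bounded_below\<close> show that \<open>y\<close> cannot be small. The second
  lower bound keeps \<open>x\<close> away from \<open>0\<close> uniformly in \<open>y\<close>.
\<close>

locale near_extreme_frame =
  fixes n :: nat and a b :: "nat \<Rightarrow> real" and x y K :: real
  assumes n: "4 \<le> n"
    and orthonormal: "orthonormal_pair n a b"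
    and pair: "\<And>i j c d. i < n \<Longrightarrow> j < n \<Longrightarrow> i \<noteq> j \<Longrightarrow>
      x * c\<^sup>2 + y * d\<^sup>2 \<le> (c * a i + d * b i)\<^sup>2 + (c * a j + d * b j)\<^sup>2"
    and y_pos: "0 < y" and K_nonneg: "0 \<le> K"
    and x_le: "x \<le> 1 / (real n - 1)"
    and x_ge: "1 / (real n - 1) - K * y \<le> x" "1 / (2 * (real n - 1)) \<le> x"
begin

abbreviation "N \<equiv> real n - 1"

lemma N_ge: "3 \<le> N" using n by simp

lemma x_pos: "0 < x"
  using x_ge(2) N_ge by (smt (verit) divide_pos_pos)

abbreviation "E \<equiv> slack_const n K"
abbreviation "M \<equiv> small_const n K"
abbreviation "R \<equiv> row_const n K"

lemma constants_nonneg: "0 \<le> E" "0 \<le> M" "0 \<le> R"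
  using frame_consts_pos[OF n K_nonneg] by simp_all

lemma norm_a: "(\<Sum>i<n. (a i)\<^sup>2) = 1" and norm_b: "(\<Sum>i<n. (b i)\<^sup>2) = 1"
  and orth: "(\<Sum>i<n. a i * b i) = 0"
  using orthonormal by (simp_all add: orthonormal_pair_def)

lemma pair_a: "i < n \<Longrightarrow> j < n \<Longrightarrow> i \<noteq> j \<Longrightarrow> x \<le> (a i)\<^sup>2 + (a j)\<^sup>2"
  using pair[of i j 1 0] by simp

lemma pair_b: "i < n \<Longrightarrow> j < n \<Longrightarrow> i \<noteq> j \<Longrightarrow> y \<le> (b i)\<^sup>2 + (b j)\<^sup>2"
  using pair[of i j 0 1] by simp

lemma pair_det:
  assumes "i < n" "j < n" "i \<noteq> j"
  shows "x * ((b i)\<^sup>2 + (b j)\<^sup>2) + y * ((a i)\<^sup>2 + (a j)\<^sup>2) - x * y \<le> (wedge a b i j)\<^sup>2"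
  by (rule pair_form_imp_wedge_bound[OF pair[OF assms]])

lemma coordinate_le: "i < n \<Longrightarrow> (a i)\<^sup>2 + (b i)\<^sup>2 \<le> 1"
  by (rule orthonormal_pair_coordinate[OF orthonormal])

lemma pair_sum_le:
  assumes "(\<Sum>i<n. (c i)\<^sup>2) = (1::real)" "i < n" "j < n" "i \<noteq> j"
  shows "(c i)\<^sup>2 + (c j)\<^sup>2 \<le> 1"
proof -
  have "(\<Sum>k\<in>{i, j}. (c k)\<^sup>2) \<le> (\<Sum>k<n. (c k)\<^sup>2)"
    using assms by (intro sum_mono2) auto
  then show ?thesis using assms by simp
qed

lemma wedge_lower:
  assumes "i < n" "j < n" "i \<noteq> j"
  shows "x * ((b i)\<^sup>2 + (b j)\<^sup>2) \<le> (wedge a b i j)\<^sup>2"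
  using pair_det[OF assms] mult_left_mono[OF pair_a[OF assms], of y] y_pos
  by (simp add: algebra_simps)

text \<open>
  The squared determinants of all pairs sum to \<open>1\<close>, and their lower bounds sum to at least
  \<open>1 - O(y)\<close> because \<open>x\<close> is so close to \<open>1 / (n - 1)\<close>. Hence no single pair can exceed its lower
  bound by more than \<open>O(y)\<close>.
\<close>

lemma wedge_upper:
  assumes kl: "k < n" "l < n" "k \<noteq> l"
  shows "(wedge a b k l)\<^sup>2 \<le> x * ((b k)\<^sup>2 + (b l)\<^sup>2) + E * y"
proof -
  define e where "e i j = (wedge a b i j)\<^sup>2 - x * ((b i)\<^sup>2 + (b j)\<^sup>2)
    - y * ((a i)\<^sup>2 + (a j)\<^sup>2) + x * y" for i j
  let ?all = "{..<n} \<times> {..<n}" and ?diag = "(\<lambda>i. (i, i)) ` {..<n}"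
  have sym: "e l k = e k l"
    by (simp add: e_def wedge_def power2_eq_square algebra_simps)
  \<comment> \<open>Sums run over ordered pairs, so each unordered pair counts twice.\<close>
  have "e k l + e l k = (\<Sum>(i, j)\<in>{(k, l), (l, k)}. e i j)"
    using kl by simp
  also have "\<dots> \<le> (\<Sum>(i, j)\<in>?all - ?diag. e i j)"
  proof (rule sum_mono2)
    show "finite (?all - ?diag)" by simp
    show "{(k, l), (l, k)} \<subseteq> ?all - ?diag" using kl by auto
    show "0 \<le> (case p of (i, j) \<Rightarrow> e i j)" if "p \<in> (?all - ?diag) - {(k, l), (l, k)}" for p
      using that pair_det by (auto simp: e_def algebra_simps image_iff)
  qed
  also have "\<dots> = (\<Sum>(i, j)\<in>?all. e i j) - (\<Sum>(i, j)\<in>?diag. e i j)"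
    by (rule sum_diff) auto
  also have "(\<Sum>(i, j)\<in>?diag. e i j) = (\<Sum>i<n. e i i)"
    by (subst sum.reindex) (auto intro: inj_onI)
  also have "(\<Sum>i<n. e i i) = (\<Sum>i<n. x * y - 2 * x * (b i)\<^sup>2 - 2 * y * (a i)\<^sup>2)"
    by (simp add: e_def wedge_def algebra_simps)
  also have "\<dots> = n * (x * y) - 2 * x - 2 * y"
    by (simp add: sum_subtractf norm_a norm_b flip: sum_distrib_left)
  also have "(\<Sum>(i, j)\<in>?all. e i j) = (\<Sum>i<n. \<Sum>j<n. e i j)"
    by (simp add: sum.cartesian_product)
  also have "\<dots> = 2 - 2 * n * x - 2 * n * y + n\<^sup>2 * (x * y)"
    using sum_wedge_squares[of "{..<n}" a b]
    by (simp add: e_def sum.distrib sum_subtractf norm_a norm_b orth power2_eq_square[of "real n"]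
        distrib_left algebra_simps flip: sum_distrib_left)
  finally have "2 * e k l \<le> 2 * (1 - N * x - N * y) + n * N * (x * y)"
    using sym by (simp add: power2_eq_square algebra_simps)
  also have "\<dots> = 2 * (1 - N * x - N * y + n * N * (x * y) / 2)" by (simp add: distrib_left)
  finally have "e k l \<le> 1 - N * x - N * y + n * N * (x * y) / 2" by simp
  moreover have "N * x \<ge> 1 - N * (K * y)"
    using mult_left_mono[OF x_ge(1), of N] N_ge by (simp add: right_diff_distrib)
  moreover have "n * N * (x * y) / 2 \<le> N * y"
  proof -
    have "N * x \<le> 1" using mult_left_mono[OF x_le, of N] N_ge by simp
    then have "n * y / 2 * (N * x) \<le> n * y / 2 * 1"
      using y_pos by (intro mult_left_mono) auto
    moreover have "n * y / 2 \<le> N * y" using y_pos N_ge by (simp add: field_simps)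
    ultimately show ?thesis by (simp add: field_simps)
  qed
  ultimately have "e k l \<le> N * K * y" by simp
  moreover have "y * ((a k)\<^sup>2 + (a l)\<^sup>2) \<le> y * 1"
    using pair_sum_le[OF norm_a kl] y_pos by (intro mult_left_mono) auto
  moreover have "0 \<le> x * y" using x_pos y_pos by simp
  ultimately show ?thesis
    unfolding e_def slack_const_def by (simp add: algebra_simps)
qed

text \<open>
  Take \<open>k\<close> with \<open>\<bar>b k\<bar>\<close> largest. By the three-term relation the products \<open>b i * b j\<close> of the other
  coordinates are \<open>O(y)\<close>, while \<open>(b i)\<^sup>2 + (b j)\<^sup>2\<close> is at least \<open>y\<close>: every \<open>b i\<close> has a partner
  \<open>b j\<close> of size at least a multiple of \<open>sqrt y\<close>, so that \<open>b i\<close> is itself at most of that order.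
  Three indices besides \<open>k\<close> are necessary for the partner to exist.
\<close>

lemma dominant_coordinate:
  obtains k where "k < n" "\<And>i. i < n \<Longrightarrow> i \<noteq> k \<Longrightarrow> (b i)\<^sup>2 \<le> M * y"
proof -
  have "\<exists>k\<in>{..<n}. \<forall>i\<in>{..<n}. \<bar>b i\<bar> \<le> \<bar>b k\<bar>"
    using n Max_in[of "(\<lambda>i. \<bar>b i\<bar>) ` {..<n}"] Max_ge[of "(\<lambda>i. \<bar>b i\<bar>) ` {..<n}"]
    by (fastforce simp: image_iff)
  then obtain k where k: "k < n" and max: "\<And>i. i < n \<Longrightarrow> \<bar>b i\<bar> \<le> \<bar>b k\<bar>" by auto
  have prod: "2 * x * \<bar>b i * b j\<bar> \<le> E * y"
    if "i < n" "j < n" "i \<noteq> j" "i \<noteq> k" "j \<noteq> k" for i j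
    by (rule three_term_bound[of i j k])
      (use that k max wedge_lower wedge_upper x_pos y_pos constants_nonneg in auto)
  have "(b i)\<^sup>2 \<le> M * y" if i: "i < n" "i \<noteq> k" for i
  proof -
    have "2 \<le> card ({..<n} - {i, k})" using n k i by (simp add: card_Diff_subset)
    then obtain j l where jl: "j \<in> {..<n} - {i, k}" "l \<in> {..<n} - {i, k}" "j \<noteq> l"
      by (metis (no_types, lifting) card_le_Suc0_iff_eq finite_Diff finite_lessThan not_less_eq_eq numeral_2_eq_2)
    then have "y \<le> (b j)\<^sup>2 + (b l)\<^sup>2" using pair_b by simp
    then have "y / 2 \<le> (b j)\<^sup>2 \<or> y / 2 \<le> (b l)\<^sup>2" by linarith
    then obtain j where j: "j < n" "j \<noteq> i" "j \<noteq> k" "y / 2 \<le> (b j)\<^sup>2"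
      using jl by blast
    have "(2 * x * \<bar>b i * b j\<bar>)\<^sup>2 \<le> (E * y)\<^sup>2"
      using prod[of i j] i j x_pos by (intro power_mono) auto
    then have sq: "4 * x\<^sup>2 * (b i)\<^sup>2 * (b j)\<^sup>2 \<le> E\<^sup>2 * y\<^sup>2"
      by (simp add: power_mult_distrib abs_mult)
    have "1 \<le> 2 * x * N" using x_ge(2) N_ge by (simp add: field_simps)
    then have "1\<^sup>2 \<le> (2 * x * N)\<^sup>2" by (intro power_mono) auto
    then have "1 \<le> 4 * x\<^sup>2 * N\<^sup>2" by (simp add: power_mult_distrib)
    have "(b i)\<^sup>2 * (y / 2) \<le> 1 * ((b i)\<^sup>2 * (b j)\<^sup>2)"
      using mult_left_mono[OF j(4), of "(b i)\<^sup>2"] by simp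
    also have "\<dots> \<le> (4 * x\<^sup>2 * N\<^sup>2) * ((b i)\<^sup>2 * (b j)\<^sup>2)"
      using \<open>1 \<le> 4 * x\<^sup>2 * N\<^sup>2\<close> by (intro mult_right_mono) auto
    also have "\<dots> = N\<^sup>2 * (4 * x\<^sup>2 * (b i)\<^sup>2 * (b j)\<^sup>2)" by simp
    also have "\<dots> \<le> N\<^sup>2 * (E\<^sup>2 * y\<^sup>2)" using sq by (intro mult_left_mono) auto
    also have "\<dots> = M * y * (y / 2)" by (simp add: small_const_def power2_eq_square)
    finally show ?thesis using y_pos by simp
  qed
  then show thesis using k that by blast
qed

text \<open>
  With \<open>b\<close> concentrated at \<open>k\<close>, the determinants with \<open>k\<close> give \<open>(a i)\<^sup>2 \<le> x + O(y)\<close> for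
  \<open>i \<noteq> k\<close>. Among three such indices two have \<open>a i * b i\<close> and \<open>a j * b j\<close> of the same sign, so the
  mixed term of their determinant only helps:
  \<open>(wedge a b i j)\<^sup>2 \<le> (a i)\<^sup>2 (b j)\<^sup>2 + (a j)\<^sup>2 (b i)\<^sup>2 \<le> x ((b i)\<^sup>2 + (b j)\<^sup>2) + O(y\<^sup>2)\<close>.
  The lower bound for the same determinant has the surplus \<open>y ((a i)\<^sup>2 + (a j)\<^sup>2 - x)\<close>, which is of
  order \<open>y\<close> since \<open>(a i)\<^sup>2 + (a j)\<^sup>2\<close> is close to \<open>2 / (n - 1)\<close>.
\<close>

lemma y_bounded_below: "1 \<le> N * (2 * R * M + N * M + N * R) * y"
proof -
  obtain k where k: "k < n" and small: "\<And>i. i < n \<Longrightarrow> i \<noteq> k \<Longrightarrow> (b i)\<^sup>2 \<le> M * y"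
    using dominant_coordinate by blast
  have card_k: "card ({..<n} - {k}) = n - 1" using k by simp
  have "(\<Sum>i\<in>{..<n} - {k}. (b i)\<^sup>2) \<le> of_nat (card ({..<n} - {k})) * (M * y)"
    using small by (intro sum_bounded_above) auto
  then have bk: "1 - N * M * y \<le> (b k)\<^sup>2"
    using norm_b sum.remove[of "{..<n}" k "\<lambda>i. (b i)\<^sup>2"] k card_k n by (simp add: of_nat_diff)
  have ak: "(a k)\<^sup>2 \<le> N * M * y" using coordinate_le[OF k] bk by simp
  have bk1: "(b k)\<^sup>2 \<le> 1" using coordinate_le[OF k] by (smt (verit) zero_le_power2)
  have ai: "(a i)\<^sup>2 \<le> x + R * y" if i: "i < n" "i \<noteq> k" for i
  proof -
    have ai1: "(a i)\<^sup>2 \<le> 1" using coordinate_le[OF i(1)] by (smt (verit) zero_le_power2)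
    have "\<bar>a i * b k\<bar> \<le> 1"
      using ai1 bk1 by (simp add: abs_mult mult_le_one abs_square_le_1)
    then have "\<bar>a k * b i\<bar> * \<bar>a i * b k\<bar> \<le> \<bar>a k * b i\<bar> * 1"
      by (intro mult_left_mono) auto
    moreover have "(a k * b i) * (a i * b k) \<le> \<bar>a k * b i\<bar> * \<bar>a i * b k\<bar>"
      by (metis abs_ge_self abs_mult)
    ultimately have "2 * ((a k * b i) * (a i * b k)) \<le> 2 * \<bar>a k * b i\<bar>"
      by linarith
    also have "\<dots> \<le> (a k)\<^sup>2 + (b i)\<^sup>2"
      using sum_squares_bound[of "\<bar>a k\<bar>" "\<bar>b i\<bar>"] by (simp add: abs_mult)
    also have "\<dots> \<le> N * M * y + M * y" using ak small[OF i] by simp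
    finally have cross: "2 * ((a k * b i) * (a i * b k)) \<le> N * M * y + M * y" .
    have "(wedge a b k i)\<^sup>2 + 2 * ((a k * b i) * (a i * b k)) = (a i)\<^sup>2 * (b k)\<^sup>2 + (a k * b i)\<^sup>2"
      by (simp add: wedge_def power2_eq_square algebra_simps)
    then have "(a i)\<^sup>2 * (b k)\<^sup>2 \<le> (wedge a b k i)\<^sup>2 + 2 * ((a k * b i) * (a i * b k))"
      using zero_le_power2[of "a k * b i"] by linarith
    also have "(wedge a b k i)\<^sup>2 \<le> x * ((b k)\<^sup>2 + (b i)\<^sup>2) + E * y"
      using wedge_upper k i by simp
    also have "x * ((b k)\<^sup>2 + (b i)\<^sup>2) \<le> x * 1"
      using pair_sum_le[OF norm_b k i(1)] i(2) x_pos by (intro mult_left_mono) auto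
    finally have "(a i)\<^sup>2 * (b k)\<^sup>2 \<le> x + E * y + (N * M * y + M * y)" using cross by simp
    moreover have "(a i)\<^sup>2 * (1 - (b k)\<^sup>2) \<le> 1 * (N * M * y)"
      using ai1 bk bk1 by (intro mult_mono) auto
    ultimately show ?thesis by (simp add: row_const_def algebra_simps)
  qed
  have "3 \<le> card ({..<n} - {k})" using card_k n by simp
  then obtain T where "T \<subseteq> {..<n} - {k}" "card T = 3"
    by (meson obtain_subset_with_card_n)
  then obtain p q r where pqr: "{p, q, r} \<subseteq> {..<n} - {k}" "p \<noteq> q" "q \<noteq> r" "p \<noteq> r"
    by (metis card_3_iff)
  have "0 \<le> (a p * b p) * (a q * b q) \<or> 0 \<le> (a q * b q) * (a r * b r) \<or> 0 \<le> (a r * b r) * (a p * b p)"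
    by (smt (verit) mult_nonneg_nonneg mult_nonpos_nonpos)
  then obtain i j where ij: "i < n" "j < n" "i \<noteq> j" "i \<noteq> k" "j \<noteq> k"
    and sign: "0 \<le> (a i * b i) * (a j * b j)"
    using pqr by (metis Diff_iff insert_subset insertCI lessThan_iff)
  have "(wedge a b i j)\<^sup>2 \<le> (a i)\<^sup>2 * (b j)\<^sup>2 + (a j)\<^sup>2 * (b i)\<^sup>2"
    using sign by (simp add: wedge_def power2_eq_square algebra_simps)
  then have "y * ((a i)\<^sup>2 + (a j)\<^sup>2 - x) \<le> ((a i)\<^sup>2 - x) * (b j)\<^sup>2 + ((a j)\<^sup>2 - x) * (b i)\<^sup>2"
    using pair_det[OF ij(1-3)] by (simp add: algebra_simps)
  also have "\<dots> \<le> (R * y) * (M * y) + (R * y) * (M * y)"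
  proof -
    have "((a i)\<^sup>2 - x) * (b j)\<^sup>2 \<le> (R * y) * (b j)\<^sup>2" "((a j)\<^sup>2 - x) * (b i)\<^sup>2 \<le> (R * y) * (b i)\<^sup>2"
      using ai[of i] ai[of j] ij by (intro mult_right_mono; simp)+
    moreover have "(R * y) * (b j)\<^sup>2 \<le> (R * y) * (M * y)" "(R * y) * (b i)\<^sup>2 \<le> (R * y) * (M * y)"
      using small[of i] small[of j] ij y_pos constants_nonneg by (intro mult_left_mono; simp)+
    ultimately show ?thesis by linarith
  qed
  finally have "y * ((a i)\<^sup>2 + (a j)\<^sup>2 - x) \<le> y * (2 * R * M * y)" by (simp add: algebra_simps)
  then have upper: "(a i)\<^sup>2 + (a j)\<^sup>2 - x \<le> 2 * R * M * y" using y_pos by simp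
  \<comment> \<open>The remaining \<open>n - 3\<close> entries of \<open>a\<close> are too small to leave less than about
    \<open>2 / (n - 1)\<close> for \<open>(a i)\<^sup>2 + (a j)\<^sup>2\<close>.\<close>
  have "(\<Sum>l\<in>{..<n} - {i, j, k}. (a l)\<^sup>2) \<le> of_nat (card ({..<n} - {i, j, k})) * (x + R * y)"
    using ai by (intro sum_bounded_above) auto
  moreover have "card ({..<n} - {i, j, k}) = n - 3" using ij k by (simp add: card_Diff_subset)
  moreover have "(\<Sum>l<n. (a l)\<^sup>2) = (\<Sum>l\<in>{..<n} - {i, j, k}. (a l)\<^sup>2) + (\<Sum>l\<in>{i, j, k}. (a l)\<^sup>2)"
    using ij k by (intro sum.subset_diff) auto
  ultimately have "1 \<le> (N - 2) * (x + R * y) + ((a i)\<^sup>2 + (a j)\<^sup>2 + (a k)\<^sup>2)"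
    using norm_a ij n by (simp add: of_nat_diff)
  then have "1 - (N - 1) * x \<le> 2 * R * M * y + (N - 2) * R * y + N * M * y"
    using upper ak by (simp add: algebra_simps)
  moreover have "(N - 1) * x \<le> (N - 1) * (1 / N)"
    using x_le N_ge by (intro mult_left_mono) auto
  moreover have "(N - 2) * R * y \<le> N * R * y"
    using constants_nonneg y_pos by (simp add: mult_right_mono)
  ultimately have "1 - (N - 1) * (1 / N) \<le> 2 * R * M * y + N * R * y + N * M * y" by linarith
  moreover have "1 - (N - 1) * (1 / N) = 1 / N" using N_ge by (simp add: field_simps)
  ultimately have "1 / N \<le> (2 * R * M + N * M + N * R) * y" by (simp add: algebra_simps)
  then show ?thesis using N_ge by (simp add: field_simps)
qed

end

lemma no_frame_near_extreme_point:
  assumes "4 \<le> n" "0 \<le> K"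
  obtains \<eta> where "0 < \<eta>" "\<And>a b x y. y < \<eta> \<Longrightarrow> \<not> near_extreme_frame n a b x y K"
proof -
  define C where "C = (real n - 1) * (2 * row_const n K * small_const n K
    + (real n - 1) * small_const n K + (real n - 1) * row_const n K)"
  have "0 < C" using frame_consts_pos[OF assms] assms by (simp add: C_def add_pos_pos)
  have "\<not> near_extreme_frame n a b x y K" if "y < 1 / C" for a b x y
  proof
    assume "near_extreme_frame n a b x y K"
    then have "1 \<le> C * y" unfolding C_def by (rule near_extreme_frame.y_bounded_below)
    then show False using that \<open>0 < C\<close> by (simp add: pos_less_divide_eq mult.commute)
  qed
  then show thesis using \<open>0 < C\<close> that[of "1 / C"] by simp
qed

section \<open>Positive semidefiniteness of the large principal submatrices\<close>

lemma psd_submatrix_iff: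
  assumes A: "A \<in> carrier_mat n n" and sym: "symmetric_mat A" and I: "I \<subseteq> {0..<n}"
  shows "psd_mat (submatrix A I I)
    \<longleftrightarrow> (\<forall>z. 0 \<le> (\<Sum>i\<in>I. \<Sum>j\<in>I. z i * (A $$ (i, j) * z j)))"
proof -
  let ?m = "card I" and ?S = "submatrix A I I"
  have finI: "finite I" using I finite_subset by blast
  have I': "{i. i < n \<and> i \<in> I} = I" using I by auto
  have S: "?S \<in> carrier_mat ?m ?m"
    using A by (auto simp: dim_submatrix I')
  have S_index: "?S $$ (i, j) = A $$ (pick I i, pick I j)" if "i < ?m" "j < ?m" for i j
    using that A by (subst submatrix_index) (auto simp: I')
  have bij: "bij_betw (pick I) {..<?m} I"
  proof -
    have inj: "inj_on (pick I) {..<?m}"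
      by (rule inj_onI) (metis lessThan_iff linorder_neqE_nat nat_neq_iff pick_mono_le)
    have "pick I ` {..<?m} \<subseteq> I" using pick_in_set_le by auto
    moreover have "card (pick I ` {..<?m}) = ?m" using card_image[OF inj] by simp
    ultimately have "pick I ` {..<?m} = I" using card_subset_eq[OF finI] by blast
    with inj show ?thesis by (simp add: bij_betw_def)
  qed
  have pick_n: "pick I i < n" if "i < ?m" for i
    using bij_betw_apply[OF bij, of i] that I by auto
  have A_sym: "A $$ (i, j) = A $$ (j, i)" if "i < n" "j < n" for i j
    using sym A that by (metis carrier_matD index_transpose_mat(1) symmetric_mat_def)
  have S_sym: "symmetric_mat ?S"
    unfolding symmetric_mat_def
    by (rule eq_matI) (use S in \<open>auto simp: S_index A_sym[OF pick_n pick_n]\<close>)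
  have form: "x \<bullet> (?S *\<^sub>v x) = (\<Sum>i<?m. \<Sum>j<?m. x $ i * (A $$ (pick I i, pick I j) * x $ j))"
    if "x \<in> carrier_vec ?m" for x
    using that S by (auto simp: scalar_prod_def S_index sum_distrib_left atLeast0LessThan intro!: sum.cong)
  have reindex: "(\<Sum>i\<in>I. \<Sum>j\<in>I. z i * (A $$ (i, j) * z j))
      = (\<Sum>i<?m. \<Sum>j<?m. z (pick I i) * (A $$ (pick I i, pick I j) * z (pick I j)))" for z
    by (simp add: sum.reindex_bij_betw[OF bij, symmetric])
  have "(\<forall>x \<in> carrier_vec ?m. 0 \<le> x \<bullet> (?S *\<^sub>v x))
    \<longleftrightarrow> (\<forall>z. 0 \<le> (\<Sum>i\<in>I. \<Sum>j\<in>I. z i * (A $$ (i, j) * z j)))" (is "?L \<longleftrightarrow> ?R")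
  proof
    assume L: ?L
    show ?R
    proof
      fix z
      have "0 \<le> vec ?m (\<lambda>i. z (pick I i)) \<bullet> (?S *\<^sub>v vec ?m (\<lambda>i. z (pick I i)))"
        using L by simp
      also have "\<dots> = (\<Sum>i\<in>I. \<Sum>j\<in>I. z i * (A $$ (i, j) * z j))"
        by (subst form) (simp_all add: reindex)
      finally show "0 \<le> (\<Sum>i\<in>I. \<Sum>j\<in>I. z i * (A $$ (i, j) * z j))" .
    qed
  next
    assume R: ?R
    show ?L
    proof
      fix x :: "real vec" assume x: "x \<in> carrier_vec ?m"
      let ?z = "\<lambda>k. x $ inv_into {..<?m} (pick I) k"
      have "?z (pick I i) = x $ i" if "i < ?m" for i
        using bij that by (simp add: bij_betw_def inv_into_f_f)
      then show "0 \<le> x \<bullet> (?S *\<^sub>v x)"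
        using R[rule_format, of ?z] by (simp add: reindex form[OF x])
    qed
  qed
  then show ?thesis using S_sym S unfolding psd_mat_def by auto
qed

text \<open>
  Both sides say that the linear map \<open>z \<mapsto> (sqrt p \<langle>f, z\<rangle>, sqrt q \<langle>g, z\<rangle>)\<close> to the plane is a
  contraction: the left side tests the map, the right side its adjoint.
\<close>

lemma quadratic_form_bound_duality:
  fixes f g :: "'a \<Rightarrow> real"
  assumes "0 < p" "0 < q"
  shows "(\<forall>z. p * (\<Sum>i\<in>I. f i * z i)\<^sup>2 + q * (\<Sum>i\<in>I. g i * z i)\<^sup>2 \<le> (\<Sum>i\<in>I. (z i)\<^sup>2))
    \<longleftrightarrow> (\<forall>c d. (\<Sum>i\<in>I. (c * f i + d * g i)\<^sup>2) \<le> c\<^sup>2 / p + d\<^sup>2 / q)" (is "?L \<longleftrightarrow> ?R")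
proof
  assume L: ?L
  show ?R
  proof (intro allI)
    fix c d
    let ?z = "\<lambda>i. c * f i + d * g i"
    define u where "u = (\<Sum>i\<in>I. f i * ?z i)"
    define v where "v = (\<Sum>i\<in>I. g i * ?z i)"
    have "(\<Sum>i\<in>I. (?z i)\<^sup>2) = c * u + d * v"
      by (simp add: u_def v_def sum_distrib_left power2_eq_square algebra_simps flip: sum.distrib)
    moreover have "p * u\<^sup>2 + q * v\<^sup>2 \<le> (\<Sum>i\<in>I. (?z i)\<^sup>2)"
      unfolding u_def v_def by (rule L[rule_format, of ?z])
    moreover have "2 * (c * u) \<le> c\<^sup>2 / p + p * u\<^sup>2" "2 * (d * v) \<le> d\<^sup>2 / q + q * v\<^sup>2"
    proof -
      have "2 * (c * u) \<le> c\<^sup>2 / p + p * u\<^sup>2" if "0 < p" for c u p :: real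
      proof -
        have "0 \<le> (c - p * u)\<^sup>2 / p" using that by simp
        also have "\<dots> = c\<^sup>2 / p + p * u\<^sup>2 - 2 * (c * u)"
          using that by (simp add: power2_eq_square field_simps)
        finally show ?thesis by simp
      qed
      then show "2 * (c * u) \<le> c\<^sup>2 / p + p * u\<^sup>2" "2 * (d * v) \<le> d\<^sup>2 / q + q * v\<^sup>2"
        using assms by blast+
    qed
    ultimately show "(\<Sum>i\<in>I. (?z i)\<^sup>2) \<le> c\<^sup>2 / p + d\<^sup>2 / q" by linarith
  qed
next
  assume R: ?R
  show ?L
  proof
    fix z
    define u where "u = (\<Sum>i\<in>I. f i * z i)"
    define v where "v = (\<Sum>i\<in>I. g i * z i)"
    let ?w = "\<lambda>i. (p * u) * f i + (q * v) * g i"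
    define Q where "Q = p * u\<^sup>2 + q * v\<^sup>2"
    have "(\<Sum>i\<in>I. ?w i * z i) = (p * u) * u + (q * v) * v"
      by (simp add: u_def v_def sum_distrib_left algebra_simps flip: sum.distrib)
    then have inner: "(\<Sum>i\<in>I. ?w i * z i) = Q" by (simp add: Q_def power2_eq_square)
    have "(\<Sum>i\<in>I. (?w i)\<^sup>2) \<le> (p * u)\<^sup>2 / p + (q * v)\<^sup>2 / q" using R by blast
    also have "\<dots> = Q" using assms by (simp add: Q_def power2_eq_square)
    finally have norm: "(\<Sum>i\<in>I. (?w i)\<^sup>2) \<le> Q" .
    \<comment> \<open>From \<open>\<langle>w, z\<rangle> = Q\<close> and \<open>\<parallel>w\<parallel>\<^sup>2 \<le> Q\<close>, expanding \<open>\<parallel>w - z\<parallel>\<^sup>2 \<ge> 0\<close> gives \<open>Q \<le> \<parallel>z\<parallel>\<^sup>2\<close>.\<close>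
    have "0 \<le> (\<Sum>i\<in>I. (?w i - z i)\<^sup>2)" by (rule sum_nonneg) simp
    also have "\<dots> = (\<Sum>i\<in>I. (?w i)\<^sup>2) - 2 * (\<Sum>i\<in>I. ?w i * z i) + (\<Sum>i\<in>I. (z i)\<^sup>2)"
      by (simp only: power2_diff sum.distrib sum_subtractf sum_distrib_left mult.assoc)
    finally show "p * (\<Sum>i\<in>I. f i * z i)\<^sup>2 + q * (\<Sum>i\<in>I. g i * z i)\<^sup>2 \<le> (\<Sum>i\<in>I. (z i)\<^sup>2)"
      using inner norm by (simp add: Q_def u_def v_def)
  qed
qed

text \<open>
  For orthonormal \<open>a\<close>, \<open>b\<close> this is the symmetric matrix with eigenvector \<open>a\<close> for \<open>s\<close>, eigenvector
  \<open>b\<close> for \<open>t\<close>, and eigenvalue \<open>1\<close> on their orthogonal complement.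
\<close>

definition rank_two_update :: "nat \<Rightarrow> real \<Rightarrow> real \<Rightarrow> (nat \<Rightarrow> real) \<Rightarrow> (nat \<Rightarrow> real) \<Rightarrow> real mat" where
  "rank_two_update n s t a b = mat n n (\<lambda>(i, j).
     (if i = j then 1 else 0) - (1 - s) * (a i * a j) - (1 - t) * (b i * b j))"

lemma rank_two_update_basics:
  "rank_two_update n s t a b \<in> carrier_mat n n" "symmetric_mat (rank_two_update n s t a b)"
proof -
  show "rank_two_update n s t a b \<in> carrier_mat n n" by (simp add: rank_two_update_def)
  show "symmetric_mat (rank_two_update n s t a b)" unfolding symmetric_mat_def
    by (rule eq_matI) (auto simp: rank_two_update_def mult.commute)
qed

text \<open>
  By duality, the submatrix on the complement \<open>I\<close> of \<open>{i, j}\<close> is positive semidefinite iff the sum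
  of \<open>(c * a k + d * b k)\<^sup>2\<close> over \<open>k \<in> I\<close> is at most \<open>c\<^sup>2 / (1 - s) + d\<^sup>2 / (1 - t)\<close> for all \<open>c\<close>,
  \<open>d\<close>. Over all indices this sum is \<open>c\<^sup>2 + d\<^sup>2\<close>, which moves the condition from \<open>I\<close> to the two
  deleted indices.
\<close>

lemma rank_two_update_locally_psd_iff:
  assumes on: "orthonormal_pair n a b" and "s < 1" "t < 1" "2 \<le> n"
  shows "rank_two_update n s t a b \<in> locally_psd n (n - 2) \<longleftrightarrow>
    (\<forall>i<n. \<forall>j<n. i \<noteq> j \<longrightarrow> (\<forall>c d. - s / (1 - s) * c\<^sup>2 + - t / (1 - t) * d\<^sup>2
       \<le> (c * a i + d * b i)\<^sup>2 + (c * a j + d * b j)\<^sup>2))"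
proof -
  let ?X = "rank_two_update n s t a b"
  let ?P = "\<lambda>i j. \<forall>c d. - s / (1 - s) * c\<^sup>2 + - t / (1 - t) * d\<^sup>2
       \<le> (c * a i + d * b i)\<^sup>2 + (c * a j + d * b j)\<^sup>2"
  have form: "(\<Sum>i\<in>I. \<Sum>j\<in>I. z i * (?X $$ (i, j) * z j))
      = (\<Sum>i\<in>I. (z i)\<^sup>2) - (1 - s) * (\<Sum>i\<in>I. a i * z i)\<^sup>2 - (1 - t) * (\<Sum>i\<in>I. b i * z i)\<^sup>2"
    if "I \<subseteq> {0..<n}" for I z
  proof -
    have fin: "finite I" using that finite_subset by blast
    have "(\<Sum>i\<in>I. \<Sum>j\<in>I. z i * (?X $$ (i, j) * z j))
        = (\<Sum>i\<in>I. \<Sum>j\<in>I. (if i = j then z i * z j else 0)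
            - (1 - s) * ((a i * z i) * (a j * z j)) - (1 - t) * ((b i * z i) * (b j * z j)))"
      using that by (intro sum.cong refl) (auto simp: rank_two_update_def algebra_simps subset_iff)
    also have "\<dots> = (\<Sum>i\<in>I. \<Sum>j\<in>I. (if i = j then z i * z j else 0))
        - (1 - s) * (\<Sum>i\<in>I. \<Sum>j\<in>I. (a i * z i) * (a j * z j))
        - (1 - t) * (\<Sum>i\<in>I. \<Sum>j\<in>I. (b i * z i) * (b j * z j))"
      by (simp only: sum_subtractf sum_distrib_left)
    also have "\<dots> = (\<Sum>i\<in>I. (z i)\<^sup>2) - (1 - s) * (\<Sum>i\<in>I. a i * z i)\<^sup>2 - (1 - t) * (\<Sum>i\<in>I. b i * z i)\<^sup>2"
      using fin by (simp add: sum.delta power2_eq_square flip: sum_product)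
    finally show ?thesis .
  qed
  have pair: "psd_mat (submatrix ?X ({0..<n} - {i, j}) ({0..<n} - {i, j})) \<longleftrightarrow> ?P i j"
    if ij: "i < n" "j < n" "i \<noteq> j" for i j
  proof -
    let ?I = "{0..<n} - {i, j}"
    have compl: "(\<Sum>k\<in>?I. (c * a k + d * b k)\<^sup>2)
        = c\<^sup>2 + d\<^sup>2 - ((c * a i + d * b i)\<^sup>2 + (c * a j + d * b j)\<^sup>2)" for c d
    proof -
      have "(\<Sum>k<n. (c * a k + d * b k)\<^sup>2)
          = (\<Sum>k<n. c\<^sup>2 * (a k)\<^sup>2 + d\<^sup>2 * (b k)\<^sup>2 + 2 * c * d * (a k * b k))"
        by (simp add: power2_eq_square algebra_simps)
      also have "\<dots> = c\<^sup>2 + d\<^sup>2"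
        using on by (simp add: orthonormal_pair_def sum.distrib flip: sum_distrib_left)
      finally have "(\<Sum>k\<in>{0..<n}. (c * a k + d * b k)\<^sup>2) = c\<^sup>2 + d\<^sup>2"
        by (simp add: atLeast0LessThan)
      moreover have "(\<Sum>k\<in>{0..<n}. (c * a k + d * b k)\<^sup>2)
          = (\<Sum>k\<in>?I. (c * a k + d * b k)\<^sup>2) + (\<Sum>k\<in>{i, j}. (c * a k + d * b k)\<^sup>2)"
        using ij by (intro sum.subset_diff) auto
      ultimately show ?thesis using ij by simp
    qed
    have "psd_mat (submatrix ?X ?I ?I)
      \<longleftrightarrow> (\<forall>z. (1 - s) * (\<Sum>i\<in>?I. a i * z i)\<^sup>2 + (1 - t) * (\<Sum>i\<in>?I. b i * z i)\<^sup>2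
              \<le> (\<Sum>i\<in>?I. (z i)\<^sup>2))"
      by (subst psd_submatrix_iff[OF rank_two_update_basics]; (subst form)?)
        (auto simp: algebra_simps)
    also have "\<dots> \<longleftrightarrow> (\<forall>c d. (\<Sum>i\<in>?I. (c * a i + d * b i)\<^sup>2) \<le> c\<^sup>2 / (1 - s) + d\<^sup>2 / (1 - t))"
      using assms by (intro quadratic_form_bound_duality) auto
    also have "\<dots> \<longleftrightarrow> ?P i j"
    proof -
      have "c\<^sup>2 - c\<^sup>2 / (1 - s) = - s / (1 - s) * c\<^sup>2" "d\<^sup>2 - d\<^sup>2 / (1 - t) = - t / (1 - t) * d\<^sup>2" for c d
        using assms by (simp_all add: field_simps)
      then show ?thesis unfolding compl by (smt (verit))
    qed
    finally show ?thesis .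
  qed
  have subsets: "I \<subseteq> {0..<n} \<and> card I = n - 2 \<longleftrightarrow>
      (\<exists>i<n. \<exists>j<n. i \<noteq> j \<and> I = {0..<n} - {i, j})" for I
  proof
    assume I: "I \<subseteq> {0..<n} \<and> card I = n - 2"
    then have "card ({0..<n} - I) = n - (n - 2)"
      by (subst card_Diff_subset) (auto intro: finite_subset)
    then have "card ({0..<n} - I) = 2" using \<open>2 \<le> n\<close> by simp
    then obtain i j where ij: "{0..<n} - I = {i, j}" "i \<noteq> j" by (auto simp: card_2_iff)
    then have "I = {0..<n} - {i, j}" using I by auto
    then show "\<exists>i<n. \<exists>j<n. i \<noteq> j \<and> I = {0..<n} - {i, j}"
      using ij by (metis Diff_iff atLeastLessThan_iff insertCI)
  next
    assume "\<exists>i<n. \<exists>j<n. i \<noteq> j \<and> I = {0..<n} - {i, j}"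
    then show "I \<subseteq> {0..<n} \<and> card I = n - 2" by (auto simp: card_Diff_subset)
  qed
  have quantify: "(\<forall>I. (\<exists>i<n. \<exists>j<n. i \<noteq> j \<and> I = F i j) \<longrightarrow> Q I)
      \<longleftrightarrow> (\<forall>i<n. \<forall>j<n. i \<noteq> j \<longrightarrow> Q (F i j))" for F and Q :: "nat set \<Rightarrow> bool"
    by blast
  have "?X \<in> locally_psd n (n - 2) \<longleftrightarrow>
      (\<forall>I. (\<exists>i<n. \<exists>j<n. i \<noteq> j \<and> I = {0..<n} - {i, j}) \<longrightarrow> psd_mat (submatrix ?X I I))"
    by (simp only: locally_psd_def mem_Collect_eq subsets rank_two_update_basics simp_thms)
  also have "\<dots> \<longleftrightarrow> (\<forall>i<n. \<forall>j<n. i \<noteq> j \<longrightarrow>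
      psd_mat (submatrix ?X ({0..<n} - {i, j}) ({0..<n} - {i, j})))"
    by (rule quantify)
  also have "\<dots> \<longleftrightarrow> (\<forall>i<n. \<forall>j<n. i \<noteq> j \<longrightarrow> ?P i j)"
    by (intro all_cong1 imp_cong refl pair)
  finally show ?thesis .
qed

section \<open>Matrices with prescribed eigenvalues\<close>

definition slice_eigenvalues :: "nat \<Rightarrow> real \<Rightarrow> real \<Rightarrow> nat \<Rightarrow> real" where
  "slice_eigenvalues n s t i = (if i < n - 2 then 1 else if i = n - 2 then s else t)"

lemma slice_vec_index:
  assumes "2 \<le> n" "i < n"
  shows "vec_of_list (replicate (n - 2) 1 @ [s, t]) $ i = slice_eigenvalues n s t i"
proof -
  have "i - (n - 2) = 0 \<or> i - (n - 2) = Suc 0" using assms by linarith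
  then show ?thesis
    using assms by (auto simp: vec_of_list_index nth_append slice_eigenvalues_def)
qed

lemma mem_two_eigenvalue_slice_iff:
  assumes "2 \<le> n"
  shows "(s, t) \<in> two_eigenvalue_slice n d \<longleftrightarrow>
    (\<exists>X \<in> locally_psd n d. similar_mat X (mat_diag n (slice_eigenvalues n s t)))"
proof -
  let ?v = "vec_of_list (replicate (n - 2) 1 @ [s, t])"
  have "length (replicate (n - 2) 1 @ [s, t]) = n" using assms by simp
  then have v: "?v \<in> carrier_vec n" by (intro carrier_vecI) (simp only: dim_vec_of_list)
  have mat_diag_cong: "mat_diag n f = mat_diag n g" if "\<And>i. i < n \<Longrightarrow> f i = g i" for f g :: "nat \<Rightarrow> real"
    unfolding mat_diag_def by (rule eq_matI) (use that in auto)
  have "mat_diag n (\<lambda>i. ?v $ i) = mat_diag n (slice_eigenvalues n s t)"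
    by (rule mat_diag_cong) (rule slice_vec_index[OF assms])
  with v show ?thesis
    unfolding two_eigenvalue_slice_def eigenvalue_vectors_def mem_Collect_eq prod.case by metis
qed

text \<open>
  Used in both directions: to diagonalise a given \<open>rank_two_update\<close>, and to recognise a given matrix
  as one by comparing eigenbases.
\<close>

lemma rank_two_update_diagonalised:
  assumes on: "orthonormal_pair n a b" and "2 \<le> n" and P: "P \<in> carrier_mat n n"
    and orth: "\<And>j. j < n - 2 \<Longrightarrow> (\<Sum>k<n. a k * P $$ (k, j)) = 0"
      "\<And>j. j < n - 2 \<Longrightarrow> (\<Sum>k<n. b k * P $$ (k, j)) = 0"
    and cols: "\<And>i. i < n \<Longrightarrow> P $$ (i, n - 2) = \<alpha> * a i" "\<And>i. i < n \<Longrightarrow> P $$ (i, n - 1) = \<beta> * b i"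
  shows "rank_two_update n s t a b * P = P * mat_diag n (slice_eigenvalues n s t)"
proof (rule eq_matI)
  let ?X = "rank_two_update n s t a b"
  show "dim_row (?X * P) = dim_row (P * mat_diag n (slice_eigenvalues n s t))"
    "dim_col (?X * P) = dim_col (P * mat_diag n (slice_eigenvalues n s t))"
    using P by (simp_all add: rank_two_update_def mat_diag_def)
  fix i j assume "i < dim_row (P * mat_diag n (slice_eigenvalues n s t))"
    "j < dim_col (P * mat_diag n (slice_eigenvalues n s t))"
  then have ij: "i < n" "j < n" using P by (simp_all add: mat_diag_def)
  have "(?X * P) $$ (i, j) = (\<Sum>k<n. ?X $$ (i, k) * P $$ (k, j))"
    using ij P rank_two_update_basics(1)[of n s t a b]
    by (simp add: scalar_prod_def atLeast0LessThan)
  also have "\<dots> = (\<Sum>k<n. (if k = i then P $$ (k, j) else 0)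
      - (1 - s) * a i * (a k * P $$ (k, j)) - (1 - t) * b i * (b k * P $$ (k, j)))"
    using ij by (intro sum.cong) (auto simp: rank_two_update_def algebra_simps)
  also have "\<dots> = P $$ (i, j) - (1 - s) * a i * (\<Sum>k<n. a k * P $$ (k, j))
      - (1 - t) * b i * (\<Sum>k<n. b k * P $$ (k, j))"
    using ij by (simp add: sum_subtractf flip: sum_distrib_left)
  also have "\<dots> = P $$ (i, j) * slice_eigenvalues n s t j"
  proof -
    have ab: "(\<Sum>k<n. a k * (\<alpha> * a k)) = \<alpha>" "(\<Sum>k<n. b k * (\<alpha> * a k)) = 0"
      "(\<Sum>k<n. a k * (\<beta> * b k)) = 0" "(\<Sum>k<n. b k * (\<beta> * b k)) = \<beta>"
      using on by (simp_all add: orthonormal_pair_def power2_eq_square mult.left_commute mult.commute[of "b _" "a _"]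
          flip: sum_distrib_left)
    consider "j < n - 2" | "j = n - 2" | "j = n - 1" "n - 1 \<noteq> n - 2" using ij \<open>2 \<le> n\<close> by linarith
    then show ?thesis
    proof cases
      case 1
      then show ?thesis by (simp add: orth slice_eigenvalues_def)
    next
      case 2
      then show ?thesis using ij by (simp add: cols ab slice_eigenvalues_def) (simp add: algebra_simps)
    next
      case 3
      moreover have "(\<Sum>k<n. a k * P $$ (k, n - 1)) = 0" "(\<Sum>k<n. b k * P $$ (k, n - 1)) = \<beta>"
        using ab(3,4) cols(2) by (simp_all del: One_nat_def)
      moreover have "slice_eigenvalues n s t (n - 1) = t"
        using 3(2) by (simp add: slice_eigenvalues_def)
      ultimately show ?thesis
        using cols(2)[OF ij(1)] by (simp add: algebra_simps)
    qed
  qed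
  also have "\<dots> = (P * mat_diag n (slice_eigenvalues n s t)) $$ (i, j)"
    using ij P by (simp add: mat_diag_mult_right)
  finally show "(?X * P) $$ (i, j) = (P * mat_diag n (slice_eigenvalues n s t)) $$ (i, j)" .
qed

lemma similar_mat_by_eigenbasis:
  fixes X D P :: "real mat"
  assumes X: "X \<in> carrier_mat n n" and D: "D \<in> carrier_mat n n" and P: "P \<in> carrier_mat n n"
    and "X * P = P * D" and "det P \<noteq> 0"
  shows "similar_mat X D"
proof -
  from det_non_zero_imp_unit[OF P \<open>det P \<noteq> 0\<close>, of "()"]
  obtain Q where Q: "Q \<in> carrier_mat n n" and QP: "Q * P = 1\<^sub>m n" "P * Q = 1\<^sub>m n"
    by (auto simp: Units_def ring_mat_def)
  have "X = X * (P * Q)" using X QP by simp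
  also have "\<dots> = P * D * Q" using X P Q \<open>X * P = P * D\<close> by (simp flip: assoc_mult_mat)
  finally show ?thesis
    unfolding similar_mat_def similar_mat_wit_def Let_def using X D P Q QP by blast
qed

text \<open>
  When the last two plane vectors are independent, the orthogonal complement of \<open>a\<close> and \<open>b\<close> has the
  basis consisting of the vectors \<open>e j + u j * e (n - 2) + v j * e (n - 1)\<close> for \<open>j < n - 2\<close>, where
  Cramer's rule gives the coefficients.
\<close>

lemma rank_two_update_similar:
  assumes on: "orthonormal_pair n a b" and "2 \<le> n" and indep: "wedge a b (n - 2) (n - 1) \<noteq> 0"
  shows "similar_mat (rank_two_update n s t a b) (mat_diag n (slice_eigenvalues n s t))"
proof -
  obtain m where n: "n = Suc (Suc m)" using \<open>2 \<le> n\<close> by (metis add_2_eq_Suc le_Suc_ex)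
  let ?\<Delta> = "wedge a b m (Suc m)"
  have \<Delta>: "?\<Delta> \<noteq> 0" using indep n by simp
  define u where "u j = - wedge a b j (Suc m) / ?\<Delta>" for j
  define v where "v j = - wedge a b m j / ?\<Delta>" for j
  define P where "P = mat n n (\<lambda>(i, j). if j = m then a i else if j = Suc m then b i
    else if i = j then 1 else if i = m then u j else if i = Suc m then v j else 0)"
  have P: "P \<in> carrier_mat n n" by (simp add: P_def)
  have column: "(\<Sum>k<n. c k * P $$ (k, j)) = c j + c m * u j + c (Suc m) * v j" if "j < m" for c j
  proof -
    have "(\<Sum>k<m. c k * P $$ (k, j)) = (\<Sum>k<m. if k = j then c k else 0)"
      using that by (intro sum.cong) (auto simp: P_def n)
    then show ?thesis using that by (simp add: n) (simp add: P_def n)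
  qed
  have cramer: "a j + a m * u j + a (Suc m) * v j = 0" "b j + b m * u j + b (Suc m) * v j = 0" for j
    using \<Delta> by (simp_all add: u_def v_def field_simps) (simp_all add: wedge_def algebra_simps)
  have orth: "(\<Sum>k<n. a k * P $$ (k, j)) = 0" "(\<Sum>k<n. b k * P $$ (k, j)) = 0" if "j < m" for j
    using that by (simp_all add: column cramer)
  have cols: "P $$ (i, m) = a i" "P $$ (i, Suc m) = b i" if "i < n" for i
    using that by (simp_all add: P_def n)
  have "rank_two_update n s t a b * P = P * mat_diag n (slice_eigenvalues n s t)"
    by (rule rank_two_update_diagonalised[OF on \<open>2 \<le> n\<close> P, where \<alpha> = 1 and \<beta> = 1])
      (use orth cols n in auto)
  moreover have "det P \<noteq> 0"
  proof
    assume "det P = 0"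
    then obtain w where w: "w \<in> carrier_vec n" "w \<noteq> 0\<^sub>v n" "P *\<^sub>v w = 0\<^sub>v n"
      using det_0_iff_vec_prod_zero_field[OF P] by blast
    have zero: "(\<Sum>j<n. P $$ (i, j) * w $ j) = 0" if "i < n" for i
    proof -
      have "(P *\<^sub>v w) $ i = (\<Sum>j<n. P $$ (i, j) * w $ j)"
        using that P w(1) by (simp add: scalar_prod_def atLeast0LessThan)
      then show ?thesis using w(3) that by simp
    qed
    \<comment> \<open>Pairing \<open>P w = 0\<close> with \<open>a\<close> and \<open>b\<close> isolates the last two entries of \<open>w\<close>.\<close>
    have test: "(\<Sum>j<n. (\<Sum>i<n. c i * P $$ (i, j)) * w $ j) = 0" for c
    proof -
      have "(\<Sum>j<n. (\<Sum>i<n. c i * P $$ (i, j)) * w $ j) = (\<Sum>j<n. \<Sum>i<n. c i * (P $$ (i, j) * w $ j))"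
        by (simp add: sum_distrib_right mult.assoc)
      also have "\<dots> = (\<Sum>i<n. c i * (\<Sum>j<n. P $$ (i, j) * w $ j))"
        by (subst sum.swap) (simp add: sum_distrib_left)
      finally show ?thesis using zero by simp
    qed
    have split: "(\<Sum>j<n. f j) = (\<Sum>j<m. f j) + f m + f (Suc m)" for f :: "nat \<Rightarrow> real"
      by (simp add: n)
    have inner: "(\<Sum>i<n. a i * P $$ (i, m)) = 1" "(\<Sum>i<n. b i * P $$ (i, m)) = 0"
      "(\<Sum>i<n. a i * P $$ (i, Suc m)) = 0" "(\<Sum>i<n. b i * P $$ (i, Suc m)) = 1"
      using on by (simp_all add: cols orthonormal_pair_def power2_eq_square mult.commute)
    have wm: "w $ m = 0"
      using test[of a] by (subst (asm) split) (simp add: orth inner)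
    have wm': "w $ Suc m = 0"
      using test[of b] by (subst (asm) split) (simp add: orth inner)
    have "w $ i = 0" if "i < m" for i
    proof -
      have "(\<Sum>j<m. P $$ (i, j) * w $ j) = (\<Sum>j<m. if j = i then w $ j else 0)"
        using that by (intro sum.cong) (auto simp: P_def n)
      then show ?thesis
        using zero[of i] that wm wm' split[of "\<lambda>j. P $$ (i, j) * w $ j"] by (simp add: n)
    qed
    then have "w = 0\<^sub>v n"
      using w(1) wm wm' by (intro eq_vecI) (auto simp: n less_Suc_eq)
    then show False using w(2) by contradiction
  qed
  ultimately show ?thesis
    using similar_mat_by_eigenbasis rank_two_update_basics(1) mat_diag_dim P by blast
qed

text \<open>
  The columns of the transforming matrix are eigenvectors, and those for different eigenvalues are
  orthogonal by symmetry. Since \<open>1\<close>, \<open>s\<close>, \<open>t\<close> are distinct, the normalised last two columns serve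
  as \<open>a\<close> and \<open>b\<close>, and the resulting \<open>rank_two_update\<close> has the same eigenbasis as \<open>X\<close>.
\<close>

lemma similar_imp_rank_two_update:
  assumes X: "X \<in> carrier_mat n n" and sym: "symmetric_mat X" and "2 \<le> n"
    and sim: "similar_mat X (mat_diag n (slice_eigenvalues n s t))"
    and distinct: "s \<noteq> 1" "t \<noteq> 1" "s \<noteq> t"
  obtains a b where "orthonormal_pair n a b" "X = rank_two_update n s t a b"
proof -
  let ?\<Lambda> = "slice_eigenvalues n s t" and ?D = "mat_diag n (slice_eigenvalues n s t)"
  obtain P Q where P: "P \<in> carrier_mat n n" and Q: "Q \<in> carrier_mat n n"
    and PQ: "P * Q = 1\<^sub>m n" "Q * P = 1\<^sub>m n" and XPQ: "X = P * ?D * Q"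
    using sim X unfolding similar_mat_def similar_mat_wit_def Let_def by auto
  have D: "?D \<in> carrier_mat n n" by simp
  have XP: "X * P = P * ?D"
  proof -
    have "X * P = P * ?D * (Q * P)"
      unfolding XPQ by (rule assoc_mult_mat[of _ n n _ n _ n]) (use P Q D in auto)
    then show ?thesis using PQ P D by simp
  qed
  have X_sym: "X $$ (i, j) = X $$ (j, i)" if "i < n" "j < n" for i j
    using sym X that by (metis carrier_matD index_transpose_mat(1) symmetric_mat_def)
  have eigen: "(\<Sum>l<n. X $$ (k, l) * P $$ (l, j)) = ?\<Lambda> j * P $$ (k, j)" if "k < n" "j < n" for k j
  proof -
    have "(\<Sum>l<n. X $$ (k, l) * P $$ (l, j)) = (X * P) $$ (k, j)"
      using that X P by (simp add: scalar_prod_def atLeast0LessThan)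
    also have "\<dots> = ?\<Lambda> j * P $$ (k, j)"
      unfolding XP using that P by (simp add: mat_diag_mult_right)
    finally show ?thesis .
  qed
  have orth: "(\<Sum>k<n. P $$ (k, i) * P $$ (k, j)) = 0" if "i < n" "j < n" "?\<Lambda> i \<noteq> ?\<Lambda> j" for i j
  proof -
    have "?\<Lambda> j * (\<Sum>k<n. P $$ (k, i) * P $$ (k, j)) = (\<Sum>k<n. P $$ (k, i) * (?\<Lambda> j * P $$ (k, j)))"
      by (simp add: sum_distrib_left mult.left_commute)
    also have "\<dots> = (\<Sum>k<n. P $$ (k, i) * (\<Sum>l<n. X $$ (k, l) * P $$ (l, j)))"
      using that by (intro sum.cong refl) (simp add: eigen)
    also have "\<dots> = (\<Sum>k<n. \<Sum>l<n. P $$ (k, i) * (X $$ (k, l) * P $$ (l, j)))"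
      by (simp add: sum_distrib_left)
    also have "\<dots> = (\<Sum>l<n. \<Sum>k<n. P $$ (l, j) * (X $$ (l, k) * P $$ (k, i)))"
      by (subst sum.swap) (intro sum.cong refl, simp add: X_sym mult_ac)
    also have "\<dots> = (\<Sum>l<n. P $$ (l, j) * (\<Sum>k<n. X $$ (l, k) * P $$ (k, i)))"
      by (simp add: sum_distrib_left)
    also have "\<dots> = (\<Sum>l<n. P $$ (l, j) * (?\<Lambda> i * P $$ (l, i)))"
      using that by (intro sum.cong refl) (simp add: eigen)
    also have "\<dots> = ?\<Lambda> i * (\<Sum>k<n. P $$ (k, i) * P $$ (k, j))"
      by (simp add: sum_distrib_left mult_ac)
    finally show ?thesis using that by simp
  qed
  define nrm where "nrm j = sqrt (\<Sum>k<n. (P $$ (k, j))\<^sup>2)" for j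
  have nrm_pos: "0 < nrm j" if "j < n" for j
  proof -
    have "(\<Sum>k<n. (P $$ (k, j))\<^sup>2) \<noteq> 0"
    proof
      assume "(\<Sum>k<n. (P $$ (k, j))\<^sup>2) = 0"
      then have "\<forall>k<n. P $$ (k, j) = 0" by (subst (asm) sum_nonneg_eq_0_iff) auto
      then have "(\<Sum>k<n. Q $$ (j, k) * P $$ (k, j)) = 0" by simp
      moreover have "(Q * P) $$ (j, j) = (\<Sum>k<n. Q $$ (j, k) * P $$ (k, j))"
        using that Q P by (simp add: scalar_prod_def atLeast0LessThan)
      ultimately show False using PQ that by simp
    qed
    then show ?thesis by (simp add: nrm_def sum_nonneg order.strict_iff_order)
  qed
  have nrm_sq: "(nrm j)\<^sup>2 = (\<Sum>k<n. (P $$ (k, j))\<^sup>2)" for j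
    by (simp add: nrm_def sum_nonneg)
  define a where "a i = P $$ (i, n - 2) / nrm (n - 2)" for i
  define b where "b i = P $$ (i, n - 1) / nrm (n - 1)" for i
  have last: "?\<Lambda> (n - 2) = s" "?\<Lambda> (n - 1) = t" "n - 2 < n" "n - 1 < n"
    using \<open>2 \<le> n\<close> by (auto simp: slice_eigenvalues_def)
  have unit: "(\<Sum>k<n. (P $$ (k, j) / nrm j)\<^sup>2) = 1" if "j < n" for j
  proof -
    have "(\<Sum>k<n. (P $$ (k, j) / nrm j)\<^sup>2) = (\<Sum>k<n. (P $$ (k, j))\<^sup>2) / (nrm j)\<^sup>2"
      by (simp only: power_divide sum_divide_distrib)
    also have "\<dots> = 1" unfolding nrm_sq[symmetric] using nrm_pos[OF that] by simp
    finally show ?thesis .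
  qed
  have inner: "(\<Sum>k<n. P $$ (k, i) / c * (P $$ (k, j) / d)) = 0"
    if "i < n" "j < n" "?\<Lambda> i \<noteq> ?\<Lambda> j" for i j c d
  proof -
    have "(\<Sum>k<n. P $$ (k, i) / c * (P $$ (k, j) / d)) = (\<Sum>k<n. P $$ (k, i) * P $$ (k, j)) / (c * d)"
      by (simp only: times_divide_times_eq sum_divide_distrib)
    then show ?thesis using orth[OF that] by simp
  qed
  have on: "orthonormal_pair n a b"
    unfolding orthonormal_pair_def a_def b_def
    by (intro conjI unit inner last(3,4), unfold last(1,2)) (rule distinct(3))
  have "rank_two_update n s t a b * P = P * ?D"
  proof (rule rank_two_update_diagonalised[OF on \<open>2 \<le> n\<close> P,
        where \<alpha> = "nrm (n - 2)" and \<beta> = "nrm (n - 1)"])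
    fix j assume j: "j < n - 2"
    then have j1: "?\<Lambda> j = 1" "j < n" by (simp_all add: slice_eigenvalues_def)
    have "?\<Lambda> (n - 2) \<noteq> ?\<Lambda> j" "?\<Lambda> (n - 1) \<noteq> ?\<Lambda> j"
      unfolding j1 last using distinct by auto
    then show "(\<Sum>k<n. a k * P $$ (k, j)) = 0" "(\<Sum>k<n. b k * P $$ (k, j)) = 0"
      using inner[OF last(3) j1(2), of _ 1] inner[OF last(4) j1(2), of _ 1]
      by (simp_all only: a_def b_def div_by_1 not_False_eq_True simp_thms)
  next
    show "P $$ (i, n - 2) = nrm (n - 2) * a i" "P $$ (i, n - 1) = nrm (n - 1) * b i" for i
      using nrm_pos[OF last(3)] nrm_pos[OF last(4)] by (simp_all add: a_def b_def)
  qed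
  then have "X = rank_two_update n s t a b * P * Q" using XPQ by simp
  also have "\<dots> = rank_two_update n s t a b * (P * Q)"
    by (rule assoc_mult_mat[OF rank_two_update_basics(1) P Q])
  finally have "X = rank_two_update n s t a b"
    using rank_two_update_basics(1)[of n s t a b] PQ by simp
  with on that show thesis by blast
qed

section \<open>Points of the slice and failure of convexity\<close>

lemma two_eigenvalue_sliceI:
  assumes on: "orthonormal_pair n a b" and "2 \<le> n" and "wedge a b (n - 2) (n - 1) \<noteq> 0"
    and "s < 1" "t < 1"
    and "\<And>i j c d. i < n \<Longrightarrow> j < n \<Longrightarrow> i \<noteq> j \<Longrightarrow> - s / (1 - s) * c\<^sup>2 + - t / (1 - t) * d\<^sup>2
       \<le> (c * a i + d * b i)\<^sup>2 + (c * a j + d * b j)\<^sup>2"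
  shows "(s, t) \<in> two_eigenvalue_slice n (n - 2)"
proof -
  have "rank_two_update n s t a b \<in> locally_psd n (n - 2)"
    unfolding rank_two_update_locally_psd_iff[OF on assms(4,5,2)] using assms(6) by blast
  then show ?thesis
    using mem_two_eigenvalue_slice_iff[OF \<open>2 \<le> n\<close>] rank_two_update_similar[OF assms(1-3)] by blast
qed

lemma two_eigenvalue_sliceE:
  assumes mem: "(s, t) \<in> two_eigenvalue_slice n (n - 2)" and "2 \<le> n" "s < 1" "t < 1" "s \<noteq> t"
  obtains a b where "orthonormal_pair n a b"
    and "\<And>i j c d. i < n \<Longrightarrow> j < n \<Longrightarrow> i \<noteq> j \<Longrightarrow> - s / (1 - s) * c\<^sup>2 + - t / (1 - t) * d\<^sup>2
       \<le> (c * a i + d * b i)\<^sup>2 + (c * a j + d * b j)\<^sup>2"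
proof -
  obtain X where X: "X \<in> locally_psd n (n - 2)"
    and sim: "similar_mat X (mat_diag n (slice_eigenvalues n s t))"
    using mem mem_two_eigenvalue_slice_iff[OF \<open>2 \<le> n\<close>] by blast
  have "X \<in> carrier_mat n n" "symmetric_mat X" using X by (simp_all add: locally_psd_def)
  then obtain a b where on: "orthonormal_pair n a b" and "X = rank_two_update n s t a b"
    using similar_imp_rank_two_update[OF _ _ \<open>2 \<le> n\<close> sim] assms by auto
  then show thesis
    using that[OF on] X rank_two_update_locally_psd_iff[OF on assms(3,4,2)] by blast
qed

text \<open>
  The witness has \<open>b\<close> concentrated in the last coordinate and \<open>a\<close> constant on the others. All
  determinant conditions are then equalities, so that this point lies on the boundary of the slice.
\<close>

lemma extreme_point_mem:
  assumes "4 \<le> n"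
  shows "(- 1 / (real n - 2), 0) \<in> two_eigenvalue_slice n (n - 2)"
proof -
  define h where "h = 1 / sqrt (real n - 1)"
  define a where "a i = (if i < n - 1 then h else 0)" for i
  define b where "b i = (if i = n - 1 then 1 else 0 :: real)" for i
  obtain m where n: "n = Suc (Suc m)" and m: "2 \<le> m"
    using assms by (metis Suc_le_D Suc_le_mono numeral_2_eq_2 numeral_nat(2) eval_nat_numeral(2,3) semiring_norm(26,27))
  have h: "h\<^sup>2 = 1 / (real n - 1)" "h \<noteq> 0" using assms by (simp_all add: h_def power_divide)
  have "orthonormal_pair n a b"
    using h m by (simp add: orthonormal_pair_def n a_def b_def)
  moreover have "wedge a b (n - 2) (n - 1) \<noteq> 0"
    using h by (simp add: wedge_def n a_def b_def)
  moreover have "1 / (real n - 2) / (1 + 1 / (real n - 2)) = h\<^sup>2"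
    using assms by (simp add: h field_simps)
  then have "- (- 1 / (real n - 2)) / (1 - - 1 / (real n - 2)) * c\<^sup>2 + - 0 / (1 - 0) * d\<^sup>2
      \<le> (c * a i + d * b i)\<^sup>2 + (c * a j + d * b j)\<^sup>2"
    if "i < n" "j < n" "i \<noteq> j" for i j c d
  proof -
    have "- (- 1 / (real n - 2)) / (1 - - 1 / (real n - 2)) * c\<^sup>2 + - 0 / (1 - 0) * d\<^sup>2 = (c * h)\<^sup>2"
      using \<open>1 / (real n - 2) / (1 + 1 / (real n - 2)) = h\<^sup>2\<close> by (simp add: power_mult_distrib)
    moreover have "(c * h)\<^sup>2 \<le> (c * a i + d * b i)\<^sup>2 + (c * a j + d * b j)\<^sup>2"
    proof (cases "i < n - 1")
      case True
      then show ?thesis by (simp add: a_def b_def)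
    next
      case False
      then have "j < n - 1" using that by linarith
      then show ?thesis by (simp add: a_def b_def)
    qed
    ultimately show ?thesis by linarith
  qed
  moreover have "- 1 / (real n - 2) < 1"
    using assms by (simp add: field_simps)
  ultimately show ?thesis
    using assms by (intro two_eigenvalue_sliceI[of n a b]) auto
qed

text \<open>
  The smallest eigenvalue of a positive semidefinite \<open>2 \<times> 2\<close> matrix \<open>M\<close> is at least its determinant
  divided by its trace: by Cayley-Hamilton, \<open>tr M * M - det M * 1 = M\<^sup>2\<close> is positive semidefinite.
\<close>

lemma planar_gram_lower_bound:
  fixes a1 a2 b1 b2 c d :: real
  shows "(a1 * b2 - a2 * b1)\<^sup>2 * (c\<^sup>2 + d\<^sup>2)
    \<le> (a1\<^sup>2 + b1\<^sup>2 + a2\<^sup>2 + b2\<^sup>2) * ((c * a1 + d * b1)\<^sup>2 + (c * a2 + d * b2)\<^sup>2)"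
proof -
  let ?u = "c * a1 + d * b1" and ?v = "c * a2 + d * b2"
  have "0 \<le> (a1 * ?u + a2 * ?v)\<^sup>2 + (b1 * ?u + b2 * ?v)\<^sup>2" by simp
  also have "\<dots> = (a1\<^sup>2 + b1\<^sup>2 + a2\<^sup>2 + b2\<^sup>2) * (?u\<^sup>2 + ?v\<^sup>2) - (a1 * b2 - a2 * b1)\<^sup>2 * (c\<^sup>2 + d\<^sup>2)"
    by (simp add: power2_eq_square algebra_simps)
  finally show ?thesis by simp
qed

text \<open>
  If the plane vectors \<open>(a i, b i)\<close> are pairwise independent, all Gram forms are positive definite and
  hence dominate a common small multiple of the identity. Pairwise independence is arranged by a
  constant \<open>a\<close> and a \<open>b\<close> with distinct entries in arithmetic progression.
\<close>

lemma diagonal_point_mem: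
  assumes "4 \<le> n"
  obtains \<epsilon> where "0 < \<epsilon>" "\<epsilon> < 1 / (real n - 2)"
    "(- \<epsilon>, - \<epsilon>) \<in> two_eigenvalue_slice n (n - 2)"
proof -
  define g where "g i = 2 * real i - (real n - 1)" for i
  define S where "S = (\<Sum>i<n. (g i)\<^sup>2)"
  define a where "a i = 1 / sqrt (real n)" for i :: nat
  define b where "b i = g i / sqrt S" for i
  have "(g 0)\<^sup>2 \<le> S"
    unfolding S_def using assms by (intro member_le_sum) auto
  moreover have "0 < (g 0)\<^sup>2" using assms by (simp add: g_def)
  ultimately have S: "0 < S" by linarith
  have "(\<Sum>i<m. 2 * real i) = m * (real m - 1)" for m
    by (induction m) (auto simp: algebra_simps)
  then have sum_g: "(\<Sum>i<n. g i) = 0"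
    by (simp add: g_def sum_subtractf)
  have on: "orthonormal_pair n a b"
    unfolding orthonormal_pair_def
  proof (intro conjI)
    show "(\<Sum>i<n. (a i)\<^sup>2) = 1" using assms by (simp add: a_def power_divide)
    have "(\<Sum>i<n. (b i)\<^sup>2) = S / S"
      using S by (simp add: b_def power_divide S_def flip: sum_divide_distrib)
    then show "(\<Sum>i<n. (b i)\<^sup>2) = 1" using S by simp
    have "(\<Sum>i<n. a i * b i) = (\<Sum>i<n. g i) / (sqrt (real n) * sqrt S)"
      by (simp add: a_def b_def sum_divide_distrib)
    then show "(\<Sum>i<n. a i * b i) = 0" using sum_g by simp
  qed
  define \<theta> where "\<theta> = 2 / (real n * S)"
  have wedge_ab: "(wedge a b i j)\<^sup>2 = 4 * (real j - real i)\<^sup>2 / (real n * S)" for i j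
  proof -
    have "wedge a b i j = 2 * (real j - real i) / (sqrt (real n) * sqrt S)"
      by (simp add: wedge_def a_def b_def g_def diff_divide_distrib[symmetric] algebra_simps)
    then show ?thesis using S by (simp only: power_divide power_mult_distrib) simp
  qed
  have form: "\<theta> * (c\<^sup>2 + d\<^sup>2) \<le> (c * a i + d * b i)\<^sup>2 + (c * a j + d * b j)\<^sup>2"
    if ij: "i < n" "j < n" "i \<noteq> j" for i j c d
  proof -
    let ?F = "(c * a i + d * b i)\<^sup>2 + (c * a j + d * b j)\<^sup>2"
    have "(1::real) \<le> \<bar>real j - real i\<bar>" using ij by linarith
    then have "1 \<le> (real j - real i)\<^sup>2" by (metis abs_le_square_iff abs_1 one_power2)
    then have "4 / (real n * S) \<le> (wedge a b i j)\<^sup>2"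
      unfolding wedge_ab using S by (intro divide_right_mono) auto
    then have "2 * \<theta> * (c\<^sup>2 + d\<^sup>2) \<le> (wedge a b i j)\<^sup>2 * (c\<^sup>2 + d\<^sup>2)"
      unfolding \<theta>_def by (intro mult_right_mono) auto
    also have "\<dots> \<le> ((a i)\<^sup>2 + (b i)\<^sup>2 + (a j)\<^sup>2 + (b j)\<^sup>2) * ?F"
      unfolding wedge_def by (rule planar_gram_lower_bound)
    also have "\<dots> \<le> 2 * ?F"
    proof (rule mult_right_mono)
      have "(a k)\<^sup>2 + (b k)\<^sup>2 \<le> 1" if "k < n" for k
        using orthonormal_pair_coordinate[OF on that] .
      from this[of i] this[of j] show "(a i)\<^sup>2 + (b i)\<^sup>2 + (a j)\<^sup>2 + (b j)\<^sup>2 \<le> 2"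
        using ij by linarith
    qed simp
    finally show ?thesis by simp
  qed
  define \<epsilon> where "\<epsilon> = min \<theta> (1 / (2 * real n))"
  have "0 < \<theta>" using S assms by (simp add: \<theta>_def)
  then have \<epsilon>: "0 < \<epsilon>" "\<epsilon> \<le> \<theta>" "\<epsilon> \<le> 1 / (2 * real n)" using assms by (simp_all add: \<epsilon>_def)
  have "1 / (2 * real n) < 1 / (real n - 2)" using assms by (simp add: field_simps)
  then have "\<epsilon> < 1 / (real n - 2)" using \<epsilon> by linarith
  moreover have "(- \<epsilon>, - \<epsilon>) \<in> two_eigenvalue_slice n (n - 2)"
  proof (rule two_eigenvalue_sliceI[OF on])
    show "2 \<le> n" "- \<epsilon> < 1" "- \<epsilon> < 1" using assms \<epsilon> by auto
    have "(wedge a b (n - 2) (n - 1))\<^sup>2 \<noteq> 0"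
      unfolding wedge_ab using S assms by (simp add: of_nat_diff)
    then show "wedge a b (n - 2) (n - 1) \<noteq> 0" by auto
    fix i j c d assume ij: "i < n" "j < n" "i \<noteq> j"
    have "\<epsilon> / (1 + \<epsilon>) \<le> \<epsilon>" using \<epsilon> by (simp add: field_simps)
    then have "\<epsilon> / (1 + \<epsilon>) \<le> \<theta>" using \<epsilon> by linarith
    then have "\<epsilon> / (1 + \<epsilon>) * (c\<^sup>2 + d\<^sup>2) \<le> \<theta> * (c\<^sup>2 + d\<^sup>2)"
      by (intro mult_right_mono) auto
    then show "- (- \<epsilon>) / (1 - - \<epsilon>) * c\<^sup>2 + - (- \<epsilon>) / (1 - - \<epsilon>) * d\<^sup>2
        \<le> (c * a i + d * b i)\<^sup>2 + (c * a j + d * b j)\<^sup>2"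
      using form[OF ij, of c d] by (simp add: distrib_left)
  qed
  ultimately show thesis using that \<epsilon>(1) by blast
qed

text \<open>
  In the coordinates \<open>x = - s / (1 - s)\<close>, \<open>y = - t / (1 - t)\<close>, the points of the segment from the
  extreme point to \<open>(- \<epsilon>, - \<epsilon>)\<close> near the former satisfy \<open>1 / (n - 1) - x \<le> K y\<close> with the fixed
  constant \<open>K = 1 / \<epsilon>\<close>, which no frame allows for small \<open>y\<close>.
\<close>

lemma two_eigenvalue_slice_not_convex:
  assumes "4 \<le> n"
  shows "\<not> convex (two_eigenvalue_slice n (n - 2))"
proof
  assume conv: "convex (two_eigenvalue_slice n (n - 2))"
  obtain \<epsilon> where \<epsilon>: "0 < \<epsilon>" "\<epsilon> < 1 / (real n - 2)"
    and diag: "(- \<epsilon>, - \<epsilon>) \<in> two_eigenvalue_slice n (n - 2)"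
    using diagonal_point_mem[OF assms] .
  define \<sigma>\<^sub>0 where "\<sigma>\<^sub>0 = 1 / (real n - 2)"
  have \<sigma>\<^sub>0: "\<epsilon> < \<sigma>\<^sub>0" "\<sigma>\<^sub>0 \<le> 1 / 2" "\<sigma>\<^sub>0 / (1 + \<sigma>\<^sub>0) = 1 / (real n - 1)"
    using \<epsilon> assms by (simp_all add: \<sigma>\<^sub>0_def field_simps)
  define K where "K = 1 / \<epsilon>"
  have K: "0 \<le> K" using \<epsilon> by (simp add: K_def)
  obtain \<eta> where \<eta>: "0 < \<eta>" "\<And>a b x y. y < \<eta> \<Longrightarrow> \<not> near_extreme_frame n a b x y K"
    using no_frame_near_extreme_point[OF assms K] by blast
  \<comment> \<open>The position on the segment. The first bound keeps \<open>x\<close> at least half of \<open>1 / (n - 1)\<close>, the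
    second makes \<open>y < \<eta>\<close>.\<close>
  define l where "l = min (1 / real n) (\<eta> / (2 * \<epsilon>))"
  have "0 < l" "l \<le> 1 / real n" "l \<le> \<eta> / (2 * \<epsilon>)" using assms \<epsilon> \<eta> by (simp_all add: l_def)
  moreover have "1 / real n \<le> 1 / (real n - 1)" "1 / real n < 1"
    using assms by (simp_all add: field_simps)
  moreover have "l * \<epsilon> \<le> \<eta> / 2"
    using \<open>l \<le> \<eta> / (2 * \<epsilon>)\<close> \<epsilon> by (simp add: field_simps)
  ultimately have l: "0 < l" "l < 1" "l \<le> 1 / (real n - 1)" "l * \<epsilon> < \<eta>"
    using \<eta>(1) by linarith+
  define \<sigma> where "\<sigma> = (1 - l) * \<sigma>\<^sub>0 + l * \<epsilon>"
  define \<tau> where "\<tau> = l * \<epsilon>"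
  have \<tau>: "0 < \<tau>" "\<tau> < \<sigma>" "\<tau> < \<eta>" "\<tau> \<le> 1"
  proof -
    show "0 < \<tau>" "\<tau> < \<eta>" using l \<epsilon> by (simp_all add: \<tau>_def)
    show "\<tau> < \<sigma>" using l \<epsilon> \<sigma>\<^sub>0 by (simp add: \<tau>_def \<sigma>_def)
    show "\<tau> \<le> 1" unfolding \<tau>_def using l \<epsilon> \<sigma>\<^sub>0 by (intro mult_le_one) auto
  qed
  have \<sigma>: "\<sigma> \<le> \<sigma>\<^sub>0" "\<sigma>\<^sub>0 - \<sigma> \<le> l / 2"
  proof -
    have diff: "\<sigma>\<^sub>0 - \<sigma> = l * (\<sigma>\<^sub>0 - \<epsilon>)" by (simp add: \<sigma>_def algebra_simps)
    then show "\<sigma> \<le> \<sigma>\<^sub>0" using l \<sigma>\<^sub>0 by (smt (verit) mult_nonneg_nonneg)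
    have "l * (\<sigma>\<^sub>0 - \<epsilon>) \<le> l * (1 / 2)" using l \<sigma>\<^sub>0 \<epsilon> by (intro mult_left_mono) auto
    then show "\<sigma>\<^sub>0 - \<sigma> \<le> l / 2" using diff by simp
  qed
  have "(1 - l) *\<^sub>R (- \<sigma>\<^sub>0, 0) + l *\<^sub>R (- \<epsilon>, - \<epsilon>) \<in> two_eigenvalue_slice n (n - 2)"
  proof (rule convexD[OF conv _ diag])
    show "(- \<sigma>\<^sub>0, 0) \<in> two_eigenvalue_slice n (n - 2)"
      using extreme_point_mem[OF assms] by (simp add: \<sigma>\<^sub>0_def)
  qed (use l in auto)
  moreover have "(1 - l) *\<^sub>R (- \<sigma>\<^sub>0, 0) + l *\<^sub>R (- \<epsilon>, - \<epsilon>) = (- \<sigma>, - \<tau>)"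
    by (simp add: \<sigma>_def \<tau>_def)
  ultimately have mem: "(- \<sigma>, - \<tau>) \<in> two_eigenvalue_slice n (n - 2)" by (simp only:)
  have "2 \<le> n" "- \<sigma> < 1" "- \<tau> < 1" "- \<sigma> \<noteq> - \<tau>" using assms \<tau> by auto
  then obtain a b where on: "orthonormal_pair n a b"
    and form: "\<And>i j c d. i < n \<Longrightarrow> j < n \<Longrightarrow> i \<noteq> j \<Longrightarrow>
      - (- \<sigma>) / (1 - - \<sigma>) * c\<^sup>2 + - (- \<tau>) / (1 - - \<tau>) * d\<^sup>2
       \<le> (c * a i + d * b i)\<^sup>2 + (c * a j + d * b j)\<^sup>2"
    using two_eigenvalue_sliceE[OF mem] by blast
  define x where "x = \<sigma> / (1 + \<sigma>)"
  define y where "y = \<tau> / (1 + \<tau>)"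
  have pair: "x * c\<^sup>2 + y * d\<^sup>2 \<le> (c * a i + d * b i)\<^sup>2 + (c * a j + d * b j)\<^sup>2"
    if "i < n" "j < n" "i \<noteq> j" for i j c d
    using form[OF that, of c d] by (simp add: x_def y_def)
  have y: "0 < y" "y < \<eta>" "\<tau> / 2 \<le> y"
  proof -
    show "0 < y" using \<tau> by (simp add: y_def)
    have "y \<le> \<tau>" using \<tau> by (simp add: y_def field_simps)
    then show "y < \<eta>" using \<tau> by simp
    show "\<tau> / 2 \<le> y" unfolding y_def using \<tau> by (intro divide_left_mono) auto
  qed
  have "0 < \<sigma>" using \<tau> by simp
  have x: "x \<le> 1 / (real n - 1)" "1 / (real n - 1) - x \<le> l / 2"
  proof -
    have eq: "1 / (real n - 1) - x = (\<sigma>\<^sub>0 - \<sigma>) / ((1 + \<sigma>\<^sub>0) * (1 + \<sigma>))"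
      unfolding \<sigma>\<^sub>0(3)[symmetric] x_def using \<open>0 < \<sigma>\<close> \<sigma> by (simp add: field_simps)
    have "1 \<le> (1 + \<sigma>\<^sub>0) * (1 + \<sigma>)" using \<open>0 < \<sigma>\<close> \<sigma> by (simp add: algebra_simps)
    then have "(\<sigma>\<^sub>0 - \<sigma>) / ((1 + \<sigma>\<^sub>0) * (1 + \<sigma>)) \<le> \<sigma>\<^sub>0 - \<sigma>" "0 \<le> (\<sigma>\<^sub>0 - \<sigma>) / ((1 + \<sigma>\<^sub>0) * (1 + \<sigma>))"
      using divide_left_mono[of 1 "(1 + \<sigma>\<^sub>0) * (1 + \<sigma>)" "\<sigma>\<^sub>0 - \<sigma>"] \<sigma> by simp_all
    then show "x \<le> 1 / (real n - 1)" "1 / (real n - 1) - x \<le> l / 2"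
      using eq \<sigma> by linarith+
  qed
  have "near_extreme_frame n a b x y K"
  proof
    show "4 \<le> n" "0 < y" "0 \<le> K" "x \<le> 1 / (real n - 1)" by fact+
    show "orthonormal_pair n a b" by fact
    have "K * (\<tau> / 2) \<le> K * y" using y K by (intro mult_left_mono) auto
    moreover have "K * (\<tau> / 2) = l / 2" using \<epsilon> by (simp add: K_def \<tau>_def)
    ultimately show "1 / (real n - 1) - K * y \<le> x" using x by linarith
    have halve: "r / 2 \<le> x" if "r - x \<le> l / 2" "l \<le> r" for r using that by linarith
    show "1 / (2 * (real n - 1)) \<le> x" using halve[OF x(2) l(3)] by (simp add: mult.commute)
    show "x * c\<^sup>2 + y * d\<^sup>2 \<le> (c * a i + d * b i)\<^sup>2 + (c * a j + d * b j)\<^sup>2"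
      if "i < n" "j < n" "i \<noteq> j" for i j c d
      using pair[OF that] .
  qed
  then show False using \<eta>(2) y(2) by blast
qed

text \<open>
  The slice is the preimage of the set of eigenvalue vectors under an affine map.
\<close>

lemma convex_two_eigenvalue_slice:
  assumes "convex_vecs (eigenvalue_vectors n (locally_psd n d))" and "2 \<le> n"
  shows "convex (two_eigenvalue_slice n d)"
proof -
  let ?vec = "\<lambda>s t. vec_of_list (replicate (n - 2) 1 @ [s, t]) :: real vec"
  have dim: "dim_vec (?vec s t) = n" for s t
    using \<open>2 \<le> n\<close> by (simp only: dim_vec_of_list) simp
  have combine: "u \<cdot>\<^sub>v ?vec s t + v \<cdot>\<^sub>v ?vec s' t' = ?vec (u * s + v * s') (u * t + v * t')"
    if "u + v = 1" for u v s t s' t'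
  proof (rule eq_vecI)
    show "dim_vec (u \<cdot>\<^sub>v ?vec s t + v \<cdot>\<^sub>v ?vec s' t') = dim_vec (?vec (u * s + v * s') (u * t + v * t'))"
      unfolding index_add_vec index_smult_vec dim ..
    fix i assume "i < dim_vec (?vec (u * s + v * s') (u * t + v * t'))"
    then have i: "i < n" unfolding dim .
    have "(u \<cdot>\<^sub>v ?vec s t + v \<cdot>\<^sub>v ?vec s' t') $ i = u * ?vec s t $ i + v * ?vec s' t' $ i"
      using i by (simp only: index_add_vec index_smult_vec dim)
    also have "\<dots> = ?vec (u * s + v * s') (u * t + v * t') $ i"
      unfolding slice_vec_index[OF \<open>2 \<le> n\<close> i] using that by (simp add: slice_eigenvalues_def)
    finally show "(u \<cdot>\<^sub>v ?vec s t + v \<cdot>\<^sub>v ?vec s' t') $ i = ?vec (u * s + v * s') (u * t + v * t') $ i" .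
  qed
  show ?thesis
  proof (rule convexI)
    fix p q :: "real \<times> real" and u v :: real
    assume mem: "p \<in> two_eigenvalue_slice n d" "q \<in> two_eigenvalue_slice n d"
      and uv: "0 \<le> u" "0 \<le> v" "u + v = 1"
    obtain s t s' t' where pq: "p = (s, t)" "q = (s', t')" by (metis surj_pair)
    have "u \<cdot>\<^sub>v ?vec s t + v \<cdot>\<^sub>v ?vec s' t' \<in> eigenvalue_vectors n (locally_psd n d)"
      using assms(1) mem uv unfolding convex_vecs_def pq two_eigenvalue_slice_def mem_Collect_eq prod.case
      by blast
    then show "u *\<^sub>R p + v *\<^sub>R q \<in> two_eigenvalue_slice n d"
      unfolding combine[OF uv(3)] by (simp only: two_eigenvalue_slice_def mem_Collect_eq prod.case pq
          scaleR_Pair add_Pair real_scaleR_def)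
  qed
qed

theorem theorem3p17:
  fixes n :: nat
  assumes "n \<ge> 4"
  shows "\<not> convex (two_eigenvalue_slice n (n - 2))
    \<and> \<not> convex_vecs (eigenvalue_vectors n (locally_psd n (n - 2)))"
  using two_eigenvalue_slice_not_convex[OF assms] convex_two_eigenvalue_slice[of n "n - 2"] assms
  by auto

end
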